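(* Let $X$ be a separable Banach space (over $\mathbb{K}=\mathbb{R}$ or $\mathbb{C}$). Then there is an equivalent norm on $X$ such that $X$ endowed with this norm has thickness $T(X)=2$ if and only if $X$ contains an isomorphic copy of $\ell_1$ (i.e. a closed subspace linearly homeomorphic to $\ell_1$ over $\mathbb{K}$).
   Context: For a Banach space $X$ with unit sphere $S_X$, the thickness of $X$ is $$T(X)=\inf\{\varepsilon>0:\ \text{there exists a finite } \varepsilon\text{-net for } S_X \text{ in } S_X\},$$ i.e. the infimum of those $\varepsilon>0$ such that $S_X$ can be covered by finitely many (closed) balls of radius $\varepsilon$ with centres in $S_X$. *)

theory Defs
  imports "HOL-Analysis.Analysis"
begin

text \<open>
  A real Banach space is a type of class \<open>banach\<close> with scalar multiplication \<open>scaleR\<close>.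
  A complex Banach space is such a type together with a complex scalar multiplication which
  extends \<open>scaleR\<close> and for which the norm is homogeneous. The other notions are parametrised
  by a scalar multiplication \<open>smul\<close> over \<open>'k\<close>, where \<open>'k\<close> is used at \<open>real\<close> and \<open>complex\<close>.
\<close>

locale complex_banach = vector_space smul
  for smul :: "complex \<Rightarrow> 'a::banach \<Rightarrow> 'a" +
  assumes smul_of_real: "smul (of_real r) x = r *\<^sub>R x"
    and norm_smul: "norm (smul c x) = norm c * norm x"

definition is_norm :: "('k::real_normed_field \<Rightarrow> 'a::ab_group_add \<Rightarrow> 'a) \<Rightarrow> ('a \<Rightarrow> real) \<Rightarrow> bool"
  where "is_norm smul N \<longleftrightarrow>
    (\<forall>x. 0 \<le> N x) \<and> (\<forall>x. N x = 0 \<longleftrightarrow> x = 0) \<and>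
    (\<forall>x y. N (x + y) \<le> N x + N y) \<and> (\<forall>c x. N (smul c x) = norm c * N x)"

definition equivalent_norm ::
    "('k::real_normed_field \<Rightarrow> 'a::banach \<Rightarrow> 'a) \<Rightarrow> ('a \<Rightarrow> real) \<Rightarrow> bool"
  where "equivalent_norm smul N \<longleftrightarrow>
    is_norm smul N \<and> (\<exists>c>0. \<exists>C>0. \<forall>x. c * norm x \<le> N x \<and> N x \<le> C * norm x)"

definition unit_sphere :: "('a \<Rightarrow> real) \<Rightarrow> 'a set"
  where "unit_sphere N = {x. N x = 1}"

text \<open>For a norm \<open>N\<close> the set below is bounded below by 0, and it contains 2, so its real
  infimum is the true one.\<close>

definition thickness :: "('a::ab_group_add \<Rightarrow> real) \<Rightarrow> real"
  where "thickness N = Inf {\<epsilon>. \<epsilon> > 0 \<and>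
    (\<exists>F. finite F \<and> F \<subseteq> unit_sphere N \<and> (\<forall>x\<in>unit_sphere N. \<exists>y\<in>F. N (x - y) \<le> \<epsilon>))}"

definition l1 :: "(nat \<Rightarrow> 'k::real_normed_field) set"
  where "l1 = {a. (\<lambda>n. norm (a n)) summable_on UNIV}"

text \<open>\<open>infsum\<close> is 0 on non-summable families, so \<open>l1_dist\<close> is nonnegative and symmetric
  even outside \<open>l1\<close>, as the locale \<open>Metric_space\<close> demands.\<close>

definition l1_dist :: "(nat \<Rightarrow> 'k::real_normed_field) \<Rightarrow> (nat \<Rightarrow> 'k) \<Rightarrow> real"
  where "l1_dist a b = (\<Sum>\<^sub>\<infinity>n. norm (a n - b n))"

lemma Metric_space_l1: "Metric_space (l1 :: (nat \<Rightarrow> 'k::real_normed_field) set) l1_dist"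
proof
  fix a b c :: "nat \<Rightarrow> 'k"
  show "0 \<le> l1_dist a b"
    unfolding l1_dist_def by (rule infsum_nonneg) simp
  show "l1_dist a b = l1_dist b a"
    unfolding l1_dist_def by (simp add: norm_minus_commute)
  have diff: "(\<lambda>n. norm (x n - y n)) summable_on UNIV" if "x \<in> l1" "y \<in> l1" for x y :: "nat \<Rightarrow> 'k"
  proof (rule summable_on_comparison_test)
    show "(\<lambda>n. norm (x n) + norm (y n)) summable_on UNIV"
      using that unfolding l1_def by (intro summable_on_add) simp_all
  qed (simp_all add: norm_triangle_ineq4)
  show "l1_dist a b = 0 \<longleftrightarrow> a = b" if "a \<in> l1" "b \<in> l1"
  proof
    assume "l1_dist a b = 0"
    then have "norm (a n - b n) = 0" for n
      using nonneg_infsum_le_0D[OF _ diff[OF that] norm_ge_zero UNIV_I, of n]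
      unfolding l1_dist_def by simp
    then show "a = b" by (simp add: fun_eq_iff)
  qed (simp add: l1_dist_def)
  show "l1_dist a c \<le> l1_dist a b + l1_dist b c" if "a \<in> l1" "b \<in> l1" "c \<in> l1"
  proof -
    have "norm (a n - c n) \<le> norm (a n - b n) + norm (b n - c n)" for n
      using norm_triangle_ineq[of "a n - b n" "b n - c n"] by simp
    then have "l1_dist a c \<le> (\<Sum>\<^sub>\<infinity>n. norm (a n - b n) + norm (b n - c n))"
      unfolding l1_dist_def using that by (intro infsum_mono summable_on_add diff)
    also have "\<dots> = l1_dist a b + l1_dist b c"
      unfolding l1_dist_def using that by (intro infsum_add diff)
    finally show ?thesis .
  qed
qed

definition l1_topology :: "(nat \<Rightarrow> 'k::real_normed_field) topology"
  where "l1_topology = Metric_space.mtopology l1 l1_dist"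

definition contains_l1 :: "('k::real_normed_field \<Rightarrow> 'a::banach \<Rightarrow> 'a) \<Rightarrow> bool"
  where "contains_l1 smul \<longleftrightarrow>
    (\<exists>Y. \<exists>T :: (nat \<Rightarrow> 'k) \<Rightarrow> 'a.
      module.subspace smul Y \<and> closed Y \<and>
      (\<forall>a\<in>l1. \<forall>b\<in>l1. T (\<lambda>n. a n + b n) = T a + T b) \<and>
      (\<forall>c. \<forall>a\<in>l1. T (\<lambda>n. c * a n) = smul c (T a)) \<and>
      homeomorphic_map l1_topology (top_of_set Y) T)"

end

theory Submission
  imports Defs
begin

text \<open>
  If the thickness is 2, compactness of spheres of finite-dimensional subspaces gives, for each
  such subspace \<open>E\<close> and \<open>\<eta> > 0\<close>, a unit vector \<open>x\<close> with \<open>N (y + t x) \<ge> (1 - \<eta>) (N y + |t|)\<close>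
  for \<open>y\<close> in \<open>E\<close>; iterating with \<open>\<eta>\<close> decreasing quickly yields a basis of a copy of \<open>\<ell>\<^sub>1\<close>.

  Conversely, let \<open>T\<close> embed \<open>\<ell>\<^sub>1\<close>, with unit vectors mapped to \<open>e\<^sub>k\<close>. Take a minimal sublinear
  functional \<open>p\<close> among those that are at least the \<open>\<ell>\<^sub>1\<close>-norm on the range of \<open>T\<close> and at most a fixed
  norm extending it. Minimality forces \<open>p (x + \<sigma> e\<^sub>k) \<rightarrow> p x + 1\<close> for every \<open>x\<close> and every unimodular
  \<open>\<sigma>\<close>, so the seminorm \<open>s x = sup p (\<theta> x)\<close> over unimodular \<open>\<theta>\<close> satisfies \<open>s (x - e\<^sub>k) \<rightarrow> s x + 1\<close>.
  Adding a multiple of the distance to the range of \<open>T\<close>, which does not see the \<open>e\<^sub>k\<close>, makes \<open>s\<close> an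
  equivalent norm \<open>N\<close> with \<open>N e\<^sub>k = 1\<close>, and the \<open>e\<^sub>k\<close> show that its thickness is 2.
\<close>

section \<open>The space of summable sequences\<close>

definition l1_norm :: "(nat \<Rightarrow> 'k::real_normed_field) \<Rightarrow> real"
  where "l1_norm a = (\<Sum>\<^sub>\<infinity>n. norm (a n))"

definition unit_seq :: "nat \<Rightarrow> nat \<Rightarrow> 'k::real_normed_field"
  where "unit_seq k n = (if n = k then 1 else 0)"

lemma l1_dist_eq: "l1_dist a b = l1_norm (\<lambda>n. a n - b n)"
  by (simp add: l1_dist_def l1_norm_def)

lemma l1_norm_nonneg [simp]: "0 \<le> l1_norm a"
  unfolding l1_norm_def by (rule infsum_nonneg) simp

lemma l1_sums:
  assumes "a \<in> l1"
  shows "(\<lambda>n. norm (a n)) sums l1_norm a"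
  using assms unfolding l1_def l1_norm_def
  by (auto intro: has_sum_imp_sums has_sum_infsum)

lemma l1I_sums:
  assumes "(\<lambda>n. norm (a n)) sums s"
  shows "a \<in> l1" and "l1_norm a = s"
proof -
  show a: "a \<in> l1"
    using assms by (auto simp: l1_def summable_on_UNIV_nonneg_real_iff sums_iff)
  show "l1_norm a = s"
    using sums_unique2[OF l1_sums[OF a] assms] .
qed

lemma l1I_bounded:
  assumes "\<And>n. (\<Sum>k<n. norm (a k)) \<le> B"
  shows "a \<in> l1" and "l1_norm a \<le> B"
proof -
  have "summable (\<lambda>n. norm (a n))"
    by (rule summableI_nonneg_bounded[where x = B]) (use assms in auto)
  then have s: "(\<lambda>n. norm (a n)) sums (\<Sum>n. norm (a n))"
    by (rule summable_sums)
  show "a \<in> l1"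
    by (rule l1I_sums[OF s])
  show "l1_norm a \<le> B"
    using LIMSEQ_le_const2[OF s[unfolded sums_def], of B] assms l1I_sums(2)[OF s] by auto
qed

lemma sum_le_l1_norm:
  assumes "a \<in> l1"
  shows "(\<Sum>k<n. norm (a k)) \<le> l1_norm a"
  using l1_sums[OF assms] sum_le_suminf[of "\<lambda>n. norm (a n)" "{..<n}"]
  by (simp add: sums_iff)

lemma l1_add:
  assumes "a \<in> l1" "b \<in> l1"
  shows "(\<lambda>n. a n + b n) \<in> l1" and "l1_norm (\<lambda>n. a n + b n) \<le> l1_norm a + l1_norm b"
proof -
  have "(\<Sum>k<n. norm (a k + b k)) \<le> l1_norm a + l1_norm b" for n
  proof -
    have "(\<Sum>k<n. norm (a k + b k)) \<le> (\<Sum>k<n. norm (a k)) + (\<Sum>k<n. norm (b k))"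
      unfolding sum.distrib[symmetric] by (intro sum_mono norm_triangle_ineq)
    also have "\<dots> \<le> l1_norm a + l1_norm b"
      by (intro add_mono sum_le_l1_norm assms)
    finally show ?thesis .
  qed
  from l1I_bounded[of "\<lambda>n. a n + b n", OF this]
  show "(\<lambda>n. a n + b n) \<in> l1" and "l1_norm (\<lambda>n. a n + b n) \<le> l1_norm a + l1_norm b" .
qed

lemma l1_scale:
  assumes "a \<in> l1"
  shows "(\<lambda>n. c * a n) \<in> l1" and "l1_norm (\<lambda>n. c * a n) = norm c * l1_norm a"
  using l1I_sums[of "\<lambda>n. c * a n", unfolded norm_mult, OF sums_mult[OF l1_sums[OF assms]]] .

lemma l1_diff:
  assumes "a \<in> l1" "b \<in> l1"
  shows "(\<lambda>n. a n - b n) \<in> l1"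
  using l1_add(1)[OF assms(1) l1_scale(1)[OF assms(2), of "-1"]] by simp

lemma l1_zero [simp]: "(\<lambda>_. 0) \<in> l1" "l1_norm (\<lambda>_. 0) = 0"
  using l1I_sums[of "\<lambda>_. 0" 0] by simp_all

lemma l1_unit_seq [simp]:
  "unit_seq k \<in> (l1 :: (nat \<Rightarrow> 'a::real_normed_field) set)"
  "l1_norm (unit_seq k :: nat \<Rightarrow> 'a) = 1"
proof -
  have "(\<lambda>n. norm (unit_seq k n :: 'a)) = (\<lambda>n. if n = k then 1 else 0)"
    by (auto simp: unit_seq_def)
  then have *: "(\<lambda>n. norm (unit_seq k n :: 'a)) sums 1"
    using sums_single[of k "\<lambda>_. 1 :: real"] by simp
  show "unit_seq k \<in> (l1 :: (nat \<Rightarrow> 'a) set)" "l1_norm (unit_seq k :: nat \<Rightarrow> 'a) = 1"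
    by (rule l1I_sums[OF *])+
qed

lemma norm_le_l1_norm:
  assumes "a \<in> l1"
  shows "norm (a k) \<le> l1_norm a"
  using l1_sums[OF assms] sum_le_suminf[of "\<lambda>n. norm (a n)" "{k}"]
  by (simp add: sums_iff)

text \<open>Beyond a suitable \<open>n\<close> the mass of \<open>a\<close> is below
  \<open>\<epsilon> / 2\<close>, and adding a sequence supported there cancels at most twice that
  mass.\<close>

lemma l1_norm_add_tail:
  assumes a: "a \<in> l1" and "\<epsilon> > 0"
  shows "\<exists>n. \<forall>w\<in>l1. (\<forall>k<n. w k = 0) \<longrightarrow>
    l1_norm a + l1_norm w - \<epsilon> \<le> l1_norm (\<lambda>k. a k + w k)"
proof -
  have "\<forall>\<^sub>F n in sequentially. (\<Sum>k<n. norm (a k)) > l1_norm a - \<epsilon> / 2"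
    using l1_sums[OF a, unfolded sums_def] \<open>\<epsilon> > 0\<close> by (intro order_tendstoD) auto
  then obtain n where n: "(\<Sum>k<n. norm (a k)) > l1_norm a - \<epsilon> / 2"
    by (auto simp: eventually_sequentially)
  define t where "t k = (if k \<in> {..<n} then 0 else norm (a k))" for k
  have t: "t sums (l1_norm a - (\<Sum>k<n. norm (a k)))"
    unfolding t_def by (rule sums_If_finite_set'[OF l1_sums[OF a]]) (auto simp: sum_negf)
  have "l1_norm a + l1_norm w - \<epsilon> \<le> l1_norm (\<lambda>k. a k + w k)"
    if w: "w \<in> l1" "\<forall>k<n. w k = 0" for w
  proof -
    \<comment> \<open>Equality for \<open>k < n\<close>, where \<open>w k\<close> vanishes; beyond,
      the reverse triangle inequality loses \<open>2 * norm (a k)\<close>.\<close>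
    have "norm (a k) + norm (w k) \<le> norm (a k + w k) + 2 * t k" for k
      using w(2) norm_triangle_ineq2[of "w k" "- a k"] by (auto simp: t_def add.commute)
    then have "l1_norm a + l1_norm w
        \<le> l1_norm (\<lambda>k. a k + w k) + 2 * (l1_norm a - (\<Sum>k<n. norm (a k)))"
      by (rule sums_le[OF _ sums_add[OF l1_sums[OF a] l1_sums[OF w(1)]]
            sums_add[OF l1_sums[OF l1_add(1)[OF a w(1)]] sums_mult[OF t]]])
    then show ?thesis
      using n by simp
  qed
  then show ?thesis by blast
qed

section \<open>Embeddings of the space of summable sequences\<close>

text \<open>Treats both scalar fields at once. The class \<open>euclidean_space\<close> supplies
  completeness of the scalars and compactness of their balls.\<close>

locale normed_scalars = vector_space smul
  for smul :: "'k::{real_normed_field,euclidean_space} \<Rightarrow> 'a::banach \<Rightarrow> 'a" +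
  assumes smul_of_real: "smul (of_real r) x = r *\<^sub>R x"
    and norm_smul: "norm (smul c x) = norm c * norm x"
begin

lemma bounded_linear_smul: "bounded_linear (smul c)"
proof
  show "smul c (r *\<^sub>R x) = r *\<^sub>R smul c x" for r x
    unfolding smul_of_real[symmetric] by (simp add: mult.commute)
  show "\<exists>K. \<forall>x. norm (smul c x) \<le> norm x * K"
    by (rule exI[of _ "norm c"]) (simp add: norm_smul)
qed (simp add: scale_right_distrib)

lemma bounded_bilinear_smul: "bounded_bilinear smul"
proof
  show "smul (r *\<^sub>R c) x = r *\<^sub>R smul c x" for r c x
    unfolding smul_of_real[symmetric] by (simp add: scaleR_conv_of_real)
  show "smul c (r *\<^sub>R x) = r *\<^sub>R smul c x" for r c x
    by (rule linear_scale[OF bounded_linear.linear[OF bounded_linear_smul]])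
  show "\<exists>K. \<forall>c x. norm (smul c x) \<le> norm c * norm x * K"
    by (rule exI[of _ 1]) (simp add: norm_smul)
qed (simp_all add: scale_right_distrib scale_left_distrib)

end

text \<open>Two-sided bounds express an isomorphic embedding without topology; closedness of the
  range and the homeomorphism property are derived from them.\<close>

locale l1_embedding = normed_scalars smul
  for smul :: "'k::{real_normed_field,euclidean_space} \<Rightarrow> 'a::banach \<Rightarrow> 'a" +
  fixes T :: "(nat \<Rightarrow> 'k) \<Rightarrow> 'a" and M C :: real
  assumes T_add: "a \<in> l1 \<Longrightarrow> b \<in> l1 \<Longrightarrow> T (\<lambda>n. a n + b n) = T a + T b"
    and T_scale: "a \<in> l1 \<Longrightarrow> T (\<lambda>n. c * a n) = smul c (T a)"
    and T_upper: "a \<in> l1 \<Longrightarrow> norm (T a) \<le> C * l1_norm a"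
    and T_lower: "a \<in> l1 \<Longrightarrow> l1_norm a \<le> M * norm (T a)"
begin

lemma T_zero: "T (\<lambda>_. 0) = 0"
  using T_scale[of "\<lambda>_. 0" 0] by simp

lemma T_diff:
  assumes "a \<in> l1" "b \<in> l1"
  shows "T (\<lambda>n. a n - b n) = T a - T b"
  using T_add[OF assms(1) l1_scale(1)[OF assms(2), of "-1"]] T_scale[OF assms(2), of "-1"]
  by simp

lemma norm_T_unit_pos: "0 < norm (T (unit_seq k))"
proof -
  have "1 \<le> M * norm (T (unit_seq k))"
    using T_lower[of "unit_seq k"] by simp
  then show ?thesis by (cases "T (unit_seq k) = 0") auto
qed

lemma M_pos: "0 < M"
proof -
  have "0 < M * norm (T (unit_seq 0))"
    using T_lower[of "unit_seq 0"] by simp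
  then show ?thesis
    using norm_T_unit_pos[of 0] by (metis zero_less_mult_pos2)
qed

lemma C_pos: "0 < C"
  using T_upper[of "unit_seq 0"] norm_T_unit_pos[of 0] by (simp del: zero_less_norm_iff)

text \<open>\<open>T_lower\<close> turns a convergent sequence of images into a Cauchy sequence of
  coefficients; the rest is completeness of \<open>l1\<close>, with the coordinatewise limit
  \<open>a\<close> as candidate.\<close>

lemma closed_range: "closed (T ` l1)"
proof (unfold closed_sequential_limits, intro allI impI, elim conjE)
  fix y l assume y: "\<forall>j. y j \<in> T ` l1" and lim: "y \<longlonglongrightarrow> l"
  then have "\<forall>j. \<exists>a. a \<in> l1 \<and> y j = T a"
    by blast
  from choice[OF this] obtain A where A: "\<And>j. A j \<in> l1" and yA: "\<And>j. y j = T (A j)"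
    by blast
  have dist: "l1_norm (\<lambda>k. A i k - A j k) \<le> M * norm (y i - y j)" for i j
    using T_lower[OF l1_diff[OF A A], of i j] by (simp add: yA T_diff A)
  have cau: "\<exists>J. \<forall>i\<ge>J. \<forall>j\<ge>J. l1_norm (\<lambda>k. A i k - A j k) < \<epsilon>" if "\<epsilon> > 0" for \<epsilon>
  proof -
    have "Cauchy y" using lim by (rule LIMSEQ_imp_Cauchy)
    moreover have "0 < \<epsilon> / M" using that M_pos by simp
    ultimately obtain J where "\<forall>i\<ge>J. \<forall>j\<ge>J. norm (y i - y j) < \<epsilon> / M"
      unfolding Cauchy_iff by blast
    moreover have "l1_norm (\<lambda>k. A i k - A j k) < \<epsilon>" if "norm (y i - y j) < \<epsilon> / M" for i j
      using dist[of i j] that M_pos by (simp add: field_simps)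
    ultimately show ?thesis by blast
  qed
  have "convergent (\<lambda>j. A j k)" for k
  proof (unfold Cauchy_convergent_iff[symmetric] Cauchy_iff, intro allI impI)
    fix \<epsilon> :: real assume "\<epsilon> > 0"
    from cau[OF this] obtain J where
      J: "\<And>i j. i \<ge> J \<Longrightarrow> j \<ge> J \<Longrightarrow> l1_norm (\<lambda>k. A i k - A j k) < \<epsilon>"
      by blast
    have "norm (A i k - A j k) < \<epsilon>" if "i \<ge> J" "j \<ge> J" for i j
      using norm_le_l1_norm[OF l1_diff[OF A[of i] A[of j]], of k] J[OF that] by linarith
    then show "\<exists>J. \<forall>i\<ge>J. \<forall>j\<ge>J. norm (A i k - A j k) < \<epsilon>" by blast
  qed
  then have "\<forall>k. \<exists>l. (\<lambda>j. A j k) \<longlonglongrightarrow> l"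
    unfolding convergent_def by blast
  from choice[OF this] obtain a where a: "\<And>k. (\<lambda>j. A j k) \<longlonglongrightarrow> a k"
    by blast
  have near: "\<exists>J. \<forall>i\<ge>J. (\<lambda>k. a k - A i k) \<in> l1 \<and> l1_norm (\<lambda>k. a k - A i k) \<le> \<epsilon>"
    if "\<epsilon> > 0" for \<epsilon>
  proof -
    from cau[OF that] obtain J where
      J: "\<And>i j. i \<ge> J \<Longrightarrow> j \<ge> J \<Longrightarrow> l1_norm (\<lambda>k. A j k - A i k) < \<epsilon>"
      by blast
    \<comment> \<open>Finite sums pass to the limit in \<open>j\<close>, so the distance of
      \<open>A i\<close> from \<open>a\<close> is bounded before \<open>a\<close> is known to lie in
      \<open>l1\<close>.\<close>
    have "(\<Sum>k<n. norm (a k - A i k)) \<le> \<epsilon>" if "i \<ge> J" for i n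
    proof (rule LIMSEQ_le_const2)
      show "(\<lambda>j. \<Sum>k<n. norm (A j k - A i k)) \<longlonglongrightarrow> (\<Sum>k<n. norm (a k - A i k))"
        by (intro tendsto_intros a)
      have "(\<Sum>k<n. norm (A j k - A i k)) \<le> \<epsilon>" if "j \<ge> J" for j
      proof -
        have "(\<Sum>k<n. norm (A j k - A i k)) \<le> l1_norm (\<lambda>k. A j k - A i k)"
          by (intro sum_le_l1_norm l1_diff A)
        then show ?thesis using J[OF \<open>i \<ge> J\<close> that] by simp
      qed
      then show "\<exists>N. \<forall>j\<ge>N. (\<Sum>k<n. norm (A j k - A i k)) \<le> \<epsilon>" by blast
    qed
    then show ?thesis using l1I_bounded[of "\<lambda>k. a k - A i k" \<epsilon> for i] by blast
  qed
  obtain i where "(\<lambda>k. a k - A i k) \<in> l1"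
    using near[of 1] by auto
  from l1_add(1)[OF this A[of i]] have al: "a \<in> l1" by simp
  have "y \<longlonglongrightarrow> T a"
  proof (rule metric_LIMSEQ_I)
    fix \<epsilon> :: real assume "\<epsilon> > 0"
    then obtain J where J: "\<And>i. i \<ge> J \<Longrightarrow> l1_norm (\<lambda>k. a k - A i k) \<le> \<epsilon> / (2 * C)"
      using near[of "\<epsilon> / (2 * C)"] C_pos by auto
    have "dist (y i) (T a) < \<epsilon>" if "i \<ge> J" for i
    proof -
      have "dist (y i) (T a) \<le> C * l1_norm (\<lambda>k. a k - A i k)"
        using T_upper[OF l1_diff[OF al A], of i]
        by (simp add: T_diff al A yA dist_norm norm_minus_commute)
      also have "\<dots> \<le> C * (\<epsilon> / (2 * C))"
        using J[OF that] C_pos by (intro mult_left_mono) auto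
      also have "\<dots> < \<epsilon>" using C_pos \<open>\<epsilon> > 0\<close> by simp
      finally show ?thesis .
    qed
    then show "\<exists>J. \<forall>i\<ge>J. dist (y i) (T a) < \<epsilon>" by blast
  qed
  then show "l \<in> T ` l1"
    using LIMSEQ_unique[OF lim] al by blast
qed

lemma inj_on_T: "inj_on T l1"
proof (rule inj_onI)
  fix a b assume ab: "a \<in> l1" "b \<in> l1" "T a = T b"
  then have "l1_norm (\<lambda>n. a n - b n) \<le> 0"
    using T_lower[OF l1_diff[OF ab(1,2)]] by (simp add: T_diff)
  then have "a n - b n = 0" for n
    using order_trans[OF norm_le_l1_norm[OF l1_diff[OF ab(1,2)], of n], of 0] by simp
  then show "a = b" by (auto simp: fun_eq_iff)
qed

text \<open>The two bounds make \<open>T\<close> and its inverse Lipschitz, with constants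
  \<open>C\<close> and \<open>M\<close>; this explains the radii \<open>r / C\<close> and
  \<open>r / M\<close>.\<close>

lemma contains_l1: "contains_l1 smul"
proof -
  interpret l1: Metric_space "l1 :: (nat \<Rightarrow> 'k) set" l1_dist
    by (rule Metric_space_l1)
  have dist_T: "dist (T a) (T b) \<le> C * l1_dist a b" "l1_dist a b \<le> M * dist (T a) (T b)"
    if "a \<in> l1" "b \<in> l1" for a b
    using T_upper[OF l1_diff[OF that]] T_lower[OF l1_diff[OF that]] that
    by (simp_all add: T_diff l1_dist_eq dist_norm)
  have cont: "continuous_map l1_topology euclidean T"
  proof (unfold continuous_map, intro conjI allI impI)
    fix U :: "'a set" assume "openin euclidean U"
    then have U: "open U" by simp
    show "openin l1_topology {x \<in> topspace l1_topology. T x \<in> U}"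
      unfolding l1_topology_def l1.openin_mtopology l1.topspace_mtopology
    proof (intro conjI allI impI)
      fix a assume "a \<in> {x \<in> l1. T x \<in> U}"
      then have a: "a \<in> l1" "T a \<in> U" by auto
      obtain r where r: "r > 0" "ball (T a) r \<subseteq> U"
        using U a(2) openE by blast
      have "l1.mball a (r / C) \<subseteq> {x \<in> l1. T x \<in> U}"
      proof
        fix b assume b: "b \<in> l1.mball a (r / C)"
        then have "dist (T a) (T b) < r"
          using dist_T(1)[of a b] a C_pos by (auto simp: field_simps)
        then show "b \<in> {x \<in> l1. T x \<in> U}"
          using b r(2) by auto
      qed
      then show "\<exists>s>0. l1.mball a s \<subseteq> {x \<in> l1. T x \<in> U}"
        using r(1) C_pos by (meson divide_pos_pos)
    qed auto
  qed simp
  have "homeomorphic_map l1_topology (top_of_set (T ` l1)) T"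
  proof (rule bijective_open_imp_homeomorphic_map)
    show "continuous_map l1_topology (top_of_set (T ` l1)) T"
      using cont by (auto simp: continuous_map_in_subtopology l1_topology_def)
    show "open_map l1_topology (top_of_set (T ` l1)) T"
    proof (unfold open_map_def, intro allI impI)
      fix O' :: "(nat \<Rightarrow> 'k) set" assume "openin l1_topology O'"
      then have O': "O' \<subseteq> l1" "\<And>a. a \<in> O' \<Longrightarrow> \<exists>r>0. l1.mball a r \<subseteq> O'"
        by (auto simp: l1_topology_def l1.openin_mtopology)
      show "openin (top_of_set (T ` l1)) (T ` O')"
      proof (unfold openin_euclidean_subtopology_iff, intro conjI ballI)
        fix y assume "y \<in> T ` O'"
        then obtain a where a: "a \<in> O'" "y = T a" by blast
        then obtain r where r: "r > 0" "l1.mball a r \<subseteq> O'" using O'(2) by blast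
        have "x \<in> T ` O'" if x: "x \<in> T ` l1" "dist x y < r / M" for x
        proof -
          obtain b where b: "b \<in> l1" "x = T b" using x(1) by blast
          have "l1_dist a b < r"
            using dist_T(2)[of a b] a b O'(1) x(2) M_pos
            by (auto simp: dist_commute field_simps)
          then have "b \<in> l1.mball a r" using a(1) b(1) O'(1) by auto
          then have "b \<in> O'" using r(2) by blast
          then show ?thesis using b(2) by blast
        qed
        then show "\<exists>e>0. \<forall>x'\<in>T ` l1. dist x' y < e \<longrightarrow> x' \<in> T ` O'"
          using r(1) M_pos by (meson divide_pos_pos)
      qed (use O' in auto)
    qed
  qed (auto simp: l1_topology_def inj_on_T)
  moreover have "subspace (T ` l1)"
  proof (rule subspaceI)
    show "0 \<in> T ` l1"
      by (rule image_eqI[where x = "\<lambda>_. 0"]) (simp_all add: T_zero)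
    show "x + y \<in> T ` l1" if "x \<in> T ` l1" "y \<in> T ` l1" for x y
      using that by (auto simp: T_add[symmetric] l1_add(1))
    show "smul c x \<in> T ` l1" if "x \<in> T ` l1" for c x
      using that by (auto simp: T_scale[symmetric] l1_scale(1))
  qed
  ultimately show ?thesis
    unfolding contains_l1_def
    by (intro exI[of _ "T ` l1"] exI[of _ T]) (auto simp: closed_range T_add T_scale)
qed

end

text \<open>A homeomorphism is continuous and open at 0, and homogeneity spreads these local facts
  to the two global bounds.\<close>

lemma (in normed_scalars) contains_l1_iff:
  "contains_l1 smul \<longleftrightarrow> (\<exists>T M C. l1_embedding smul T M C)"
proof
  assume "contains_l1 smul"
  then obtain Y T where
    add: "\<And>a b. a \<in> l1 \<Longrightarrow> b \<in> l1 \<Longrightarrow> T (\<lambda>n. a n + b n) = T a + T b" and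
    scale: "\<And>c a. a \<in> l1 \<Longrightarrow> T (\<lambda>n. c * a n) = smul c (T a)" and
    hom: "homeomorphic_map l1_topology (top_of_set Y) T"
    unfolding contains_l1_def by blast
  interpret l1: Metric_space "l1 :: (nat \<Rightarrow> 'k) set" l1_dist
    by (rule Metric_space_l1)
  have zero: "T (\<lambda>_. 0) = 0"
    using scale[of "\<lambda>_. 0" 0] by simp
  have YT: "Y = T ` l1" and inj: "inj_on T l1"
    using hom by (auto simp: homeomorphic_eq_everything_map l1_topology_def)
  have resc: "(\<lambda>n. of_real r * a n) \<in> l1" "T (\<lambda>n. of_real r * a n) = r *\<^sub>R T a"
    "l1_norm (\<lambda>n. of_real r * a n) = \<bar>r\<bar> * l1_norm a" if "a \<in> l1" for a r
    using that by (simp_all add: l1_scale scale smul_of_real)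
  obtain r where r: "r > 0" and rT: "\<And>a. a \<in> l1 \<Longrightarrow> l1_norm a < r \<Longrightarrow> norm (T a) < 1"
  proof -
    have "continuous_map l1_topology euclidean T"
      using homeomorphic_imp_continuous_map[OF hom] by (simp add: continuous_map_in_subtopology)
    from openin_continuous_map_preimage[OF this, of "ball 0 1"]
    have "openin l1_topology {a \<in> l1. T a \<in> ball 0 1}"
      by (simp add: l1_topology_def)
    moreover have "(\<lambda>_. 0) \<in> {a \<in> l1. T a \<in> ball 0 1}"
      using zero by simp
    ultimately obtain r where "r > 0" "l1.mball (\<lambda>_. 0) r \<subseteq> {a \<in> l1. T a \<in> ball 0 1}"
      unfolding l1_topology_def l1.openin_mtopology by blast
    then show ?thesis
      by (intro that[of r]) (auto simp: subset_iff l1.commute[of "\<lambda>_. 0"] l1_dist_eq)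
  qed
  obtain s where s: "s > 0" and sT: "\<And>a. a \<in> l1 \<Longrightarrow> norm (T a) < s \<Longrightarrow> l1_norm a < 1"
  proof -
    have "open_map l1_topology (top_of_set Y) T"
      using hom by (simp add: homeomorphic_eq_everything_map)
    then have "openin (top_of_set Y) (T ` l1.mball (\<lambda>_. 0) 1)"
      unfolding open_map_def l1_topology_def using l1.openin_mball by blast
    moreover have "0 \<in> T ` l1.mball (\<lambda>_. 0) 1"
      by (rule image_eqI[where x = "\<lambda>_. 0"]) (simp_all add: zero)
    ultimately obtain s where "s > 0" and s: "\<forall>x'\<in>Y. dist x' 0 < s \<longrightarrow> x' \<in> T ` l1.mball (\<lambda>_. 0) 1"
      unfolding openin_euclidean_subtopology_iff by blast
    have "l1_norm a < 1" if "a \<in> l1" "norm (T a) < s" for a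
    proof -
      \<comment> \<open>Injectivity turns membership in the image of the ball into a bound on the
        coefficients themselves.\<close>
      have "T a \<in> T ` l1.mball (\<lambda>_. 0) 1" using s that by (auto simp: YT)
      then have "a \<in> l1.mball (\<lambda>_. 0) 1"
        using inj_on_image_mem_iff[OF inj that(1) l1.mball_subset_mspace] by blast
      then show ?thesis by (auto simp: l1.commute[of "\<lambda>_. 0"] l1_dist_eq)
    qed
    then show ?thesis using that \<open>s > 0\<close> by blast
  qed
  have upper: "norm (T a) \<le> 2 / r * l1_norm a" if a: "a \<in> l1" for a
  proof (rule ccontr)
    assume c: "\<not> ?thesis"
    moreover have "0 \<le> 2 / r * l1_norm a" using r by simp
    ultimately have p: "norm (T a) > 0" by linarith
    \<comment> \<open>After this rescaling the image has norm exactly 1, so the bound supplied by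
      \<open>rT\<close> is a contradiction.\<close>
    have "norm (T (\<lambda>n. of_real (1 / norm (T a)) * a n)) < 1"
    proof (rule rT[OF resc(1)[OF a]])
      have "2 * l1_norm a < r * norm (T a)"
        using c r by (simp add: field_simps)
      moreover have "0 < r * norm (T a)"
        using r p by simp
      ultimately have "l1_norm a < r * norm (T a)"
        using l1_norm_nonneg[of a] by linarith
      then show "l1_norm (\<lambda>n. of_real (1 / norm (T a)) * a n) < r"
        unfolding resc(3)[OF a] using p by (simp add: field_simps)
    qed
    then show False using p by (simp only: resc[OF a]) simp
  qed
  have lower: "l1_norm a \<le> 2 / s * norm (T a)" if a: "a \<in> l1" for a
  proof (rule ccontr)
    assume c: "\<not> ?thesis"
    moreover have "0 \<le> 2 / s * norm (T a)" using s by simp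
    ultimately have p: "l1_norm a > 0" by linarith
    have "l1_norm (\<lambda>n. of_real (1 / l1_norm a) * a n) < 1"
    proof (rule sT[OF resc(1)[OF a]])
      have "2 * norm (T a) < s * l1_norm a"
        using c s by (simp add: field_simps)
      moreover have "0 < s * l1_norm a"
        using s p by simp
      ultimately have "norm (T a) < s * l1_norm a"
        using norm_ge_zero[of "T a"] by linarith
      then show "norm (T (\<lambda>n. of_real (1 / l1_norm a) * a n)) < s"
        unfolding resc(2)[OF a] using p by (simp add: field_simps)
    qed
    then show False using p by (simp only: resc[OF a]) simp
  qed
  have "l1_embedding smul T (2 / s) (2 / r)"
    by unfold_locales (use add scale upper lower in auto)
  then show "\<exists>T M C. l1_embedding smul T M C" by blast
next
  assume "\<exists>T M C. l1_embedding smul T M C"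
  then show "contains_l1 smul" by (auto intro: l1_embedding.contains_l1)
qed


section \<open>Thickness two yields summable sequences\<close>

locale equivalent_renorming = normed_scalars smul
  for smul :: "'k::{real_normed_field,euclidean_space} \<Rightarrow> 'a::banach \<Rightarrow> 'a" +
  fixes N :: "'a \<Rightarrow> real"
  assumes equivalent_norm: "equivalent_norm smul N"
begin

lemma N_nonneg [simp]: "0 \<le> N x"
  and N_eq_0 [simp]: "N x = 0 \<longleftrightarrow> x = 0"
  and N_triangle: "N (x + y) \<le> N x + N y"
  and N_smul: "N (smul c x) = norm c * N x"
  using equivalent_norm by (auto simp: equivalent_norm_def is_norm_def)

lemma N_zero [simp]: "N 0 = 0"
  by simp

lemma N_scaleR: "N (r *\<^sub>R x) = \<bar>r\<bar> * N x"
  using N_smul[of "of_real r"] by (simp add: smul_of_real)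

lemma N_minus [simp]: "N (- x) = N x"
  using N_scaleR[of "-1"] by simp

lemma N_minus_commute: "N (x - y) = N (y - x)"
  using N_minus[of "x - y"] by simp

lemma N_triangle_diff: "N (x - z) \<le> N (x - y) + N (y - z)"
  using N_triangle[of "x - y" "y - z"] by simp

lemma N_diff_le: "N x - N y \<le> N (x - y)"
  using N_triangle[of "x - y" y] by simp

lemma N_bounds: "\<exists>l>0. \<exists>u>0. \<forall>x. l * norm x \<le> N x \<and> N x \<le> u * norm x"
  using equivalent_norm by (auto simp: equivalent_norm_def)

lemma continuous_on_N: "continuous_on S N"
proof -
  obtain l u where "l > 0" "u > 0" and lu: "\<forall>x. l * norm x \<le> N x \<and> N x \<le> u * norm x"
    using N_bounds by blast
  then have u: "N x \<le> u * norm x" for x by blast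
  have "u-lipschitz_on S N"
  proof (rule lipschitz_onI)
    show "dist (N x) (N y) \<le> u * dist x y" for x y
      using N_diff_le[of x y] N_diff_le[of y x] u[of "x - y"]
      by (auto simp: dist_norm N_minus_commute[of y])
  qed (use \<open>u > 0\<close> in simp)
  then show ?thesis by (rule lipschitz_on_continuous_on)
qed

section \<open>Thickness two in terms of distant unit vectors\<close>

lemma thickness_2D:
  assumes "thickness N = 2" "finite F" "F \<subseteq> unit_sphere N" "\<epsilon> < 2"
  shows "\<exists>x. N x = 1 \<and> (\<forall>y\<in>F. \<epsilon> < N (x - y))"
proof (rule ccontr)
  let ?A = "{\<epsilon>. \<epsilon> > 0 \<and>
    (\<exists>F. finite F \<and> F \<subseteq> unit_sphere N \<and> (\<forall>x\<in>unit_sphere N. \<exists>y\<in>F. N (x - y) \<le> \<epsilon>))}"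
  assume "\<not> ?thesis"
  \<comment> \<open>\<open>max \<epsilon> 1\<close> is positive, as membership in the set
    \<open>?A\<close> demands, and still below 2.\<close>
  then have "\<forall>x\<in>unit_sphere N. \<exists>y\<in>F. N (x - y) \<le> max \<epsilon> 1"
    unfolding unit_sphere_def by (fastforce simp: not_less)
  then have "max \<epsilon> 1 \<in> ?A"
    using assms(2,3) by auto
  moreover have "bdd_below ?A"
    by (rule bdd_belowI[of _ 0]) auto
  ultimately have "thickness N \<le> max \<epsilon> 1"
    unfolding thickness_def by (rule cInf_lower)
  then show False using assms(1,4) by simp
qed

lemma thickness_2I:
  assumes "N x0 = 1"
    and far: "\<And>F \<epsilon>. finite F \<Longrightarrow> F \<subseteq> unit_sphere N \<Longrightarrow> \<epsilon> < 2 \<Longrightarrow>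
      \<exists>x. N x = 1 \<and> (\<forall>y\<in>F. \<epsilon> < N (x - y))"
  shows "thickness N = 2"
  unfolding thickness_def
proof (rule cInf_eq_minimum)
  \<comment> \<open>A single point of the sphere is already a 2-net.\<close>
  have "N (x - x0) \<le> 2" if "N x = 1" for x
    using N_triangle[of x "- x0"] that assms(1) by simp
  then show "2 \<in> {\<epsilon>. \<epsilon> > 0 \<and>
    (\<exists>F. finite F \<and> F \<subseteq> unit_sphere N \<and> (\<forall>x\<in>unit_sphere N. \<exists>y\<in>F. N (x - y) \<le> \<epsilon>))}"
    using assms(1) by (auto simp: unit_sphere_def intro!: exI[of _ "{x0}"])
next
  fix \<epsilon> assume "\<epsilon> \<in> {\<epsilon>. \<epsilon> > 0 \<and>
    (\<exists>F. finite F \<and> F \<subseteq> unit_sphere N \<and> (\<forall>x\<in>unit_sphere N. \<exists>y\<in>F. N (x - y) \<le> \<epsilon>))}"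
  then obtain F where F: "finite F" "F \<subseteq> unit_sphere N"
    "\<forall>x\<in>unit_sphere N. \<exists>y\<in>F. N (x - y) \<le> \<epsilon>"
    by blast
  show "2 \<le> \<epsilon>"
  proof (rule ccontr)
    assume "\<not> 2 \<le> \<epsilon>"
    then obtain x where "N x = 1" "\<forall>y\<in>F. \<epsilon> < N (x - y)"
      using far[OF F(1,2), of \<epsilon>] by auto
    then show False using F(3) unfolding unit_sphere_def by fastforce
  qed
qed

lemma far_from_compact:
  assumes "thickness N = 2" "compact D" "D \<subseteq> unit_sphere N" "\<epsilon> < 2"
  shows "\<exists>x. N x = 1 \<and> (\<forall>y\<in>D. \<epsilon> < N (x - y))"
proof -
  obtain l u where "l > 0" "u > 0" and lu: "\<forall>x. l * norm x \<le> N x \<and> N x \<le> u * norm x"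
    using N_bounds by blast
  then have u: "N x \<le> u * norm x" for x by blast
  \<comment> \<open>Half of the gap to 2 is spent on replacing \<open>D\<close> by a finite net; its
    radius is divided by \<open>u\<close> to pass from \<open>norm\<close> to
    \<open>N\<close>.\<close>
  define \<delta> where "\<delta> = (2 - \<epsilon>) / 2"
  have "\<delta> > 0" using assms(4) by (simp add: \<delta>_def)
  have "0 < \<delta> / u"
    using \<open>\<delta> > 0\<close> \<open>u > 0\<close> by simp
  then obtain F where F: "finite F" "F \<subseteq> D" "D \<subseteq> (\<Union>x\<in>F. ball x (\<delta> / u))"
    using seq_compact_imp_totally_bounded[OF compact_imp_seq_compact[OF assms(2)]] by meson
  obtain x where x: "N x = 1" "\<And>y. y \<in> F \<Longrightarrow> \<epsilon> + \<delta> < N (x - y)"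
    using thickness_2D[OF assms(1) F(1), of "\<epsilon> + \<delta>"] F(2) assms(3,4)
    by (fastforce simp: \<delta>_def field_simps)
  have "\<epsilon> < N (x - y)" if y: "y \<in> D" for y
  proof -
    obtain z where z: "z \<in> F" "dist z y < \<delta> / u"
      using F(3) y by auto
    have "N (y - z) \<le> u * norm (y - z)" by (rule u)
    also have "\<dots> < \<delta>"
      using z(2) \<open>u > 0\<close> by (simp add: dist_norm norm_minus_commute field_simps)
    finally show ?thesis
      using x(2)[OF z(1)] N_triangle_diff[of x z y] by simp
  qed
  then show ?thesis using x(1) by blast
qed

section \<open>Building a basis of a copy of the summable sequences\<close>

text \<open>Bounding coefficients rather than vectors makes the set a continuous image of a product
  of scalar balls, whether or not the \<open>e k\<close> are independent; the induction adds one
  ball at a time.\<close>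

lemma compact_combinations:
  fixes n :: nat
  shows "compact {\<Sum>k<n. smul (a k) (e k) | a. \<forall>k<n. norm (a k) \<le> R}"
proof (induction n)
  case 0
  show ?case by simp
next
  case (Suc n)
  let ?K = "\<lambda>n. {\<Sum>k<n. smul (a k) (e k) | a. \<forall>k<n. norm (a k) \<le> R}"
  have "?K (Suc n) = (\<lambda>p. fst p + smul (snd p) (e n)) ` (?K n \<times> cball 0 R)" (is "_ = ?I")
  proof
    show "?K (Suc n) \<subseteq> ?I"
    proof
      fix x assume "x \<in> ?K (Suc n)"
      then obtain a where a: "\<forall>k<Suc n. norm (a k) \<le> R" "x = (\<Sum>k<Suc n. smul (a k) (e k))"
        by blast
      show "x \<in> ?I"
        by (rule image_eqI[where x = "(\<Sum>k<n. smul (a k) (e k), a n)"]) (use a in auto)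
    qed
    show "?I \<subseteq> ?K (Suc n)"
    proof
      fix x assume "x \<in> ?I"
      then obtain a c where a: "\<forall>k<n. norm (a k) \<le> R" and c: "norm c \<le> R"
        and x: "x = (\<Sum>k<n. smul (a k) (e k)) + smul c (e n)"
        by auto
      have "x = (\<Sum>k<Suc n. smul ((a(n := c)) k) (e k))"
        unfolding x by simp
      moreover have "\<forall>k<Suc n. norm ((a(n := c)) k) \<le> R"
        using a c by (auto simp: less_Suc_eq)
      ultimately show "x \<in> ?K (Suc n)" by blast
    qed
  qed
  moreover have "compact ?I"
    by (intro compact_continuous_image compact_Times Suc.IH compact_cball continuous_intros
        bounded_bilinear.continuous_on[OF bounded_bilinear_smul])
  ultimately show ?case by simp
qed

text \<open>The lower estimate bounds the coefficients of unit vectors in the span, whose unit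
  sphere is therefore compact. Thickness 2 yields a unit vector at distance almost 2 from it, and
  the defect is paid by lowering \<open>c\<close> to \<open>c'\<close>.\<close>

lemma extend_l1_basis:
  fixes e :: "nat \<Rightarrow> 'a"
  assumes thick: "thickness N = 2" and c: "0 < c'" "c' < c" "c \<le> 1"
    and low: "\<And>a. c * (\<Sum>k<n. norm (a k)) \<le> N (\<Sum>k<n. smul (a k) (e k))"
  shows "\<exists>x. N x = 1 \<and> (\<forall>a t. c' * ((\<Sum>k<n. norm (a k)) + norm t)
    \<le> N ((\<Sum>k<n. smul (a k) (e k)) + smul t x))"
proof -
  \<comment> \<open>Chosen so that \<open>(1 - \<eta>) * c = c'\<close>.\<close>
  define \<eta> where "\<eta> = 1 - c' / c"
  have \<eta>: "0 < \<eta>" "\<eta> < 1" "(1 - \<eta>) * c = c'"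
    using c by (auto simp: \<eta>_def)
  let ?E = "range (\<lambda>a. \<Sum>k<n. smul (a k) (e k))"
  let ?K = "{\<Sum>k<n. smul (a k) (e k) | a. \<forall>k<n. norm (a k) \<le> 1 / c}"
  have E_smul: "smul b y \<in> ?E" if "y \<in> ?E" for b y
  proof -
    from that obtain a where "y = (\<Sum>k<n. smul (a k) (e k))" by blast
    then have "smul b y = (\<Sum>k<n. smul (b * a k) (e k))"
      by (simp add: scale_sum_right)
    then show ?thesis by (intro range_eqI[where x = "\<lambda>k. b * a k"]) simp
  qed
  let ?D = "?K \<inter> N -` {1}"
  have "compact ?D"
    by (intro compact_Int_closed compact_combinations closed_vimage closed_singleton
        continuous_on_N)
  moreover have "?D \<subseteq> unit_sphere N"
    by (auto simp: unit_sphere_def)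
  ultimately have "\<exists>x. N x = 1 \<and> (\<forall>y\<in>?D. 2 - \<eta> < N (x - y))"
    using \<eta>(1) by (intro far_from_compact[OF thick]) auto
  then obtain x where "N x = 1" and xD: "\<forall>y\<in>?D. 2 - \<eta> < N (x - y)"
    by blast
  have x: "N x = 1" "\<And>y. y \<in> ?K \<Longrightarrow> N y = 1 \<Longrightarrow> 2 - \<eta> < N (x - y)"
    using \<open>N x = 1\<close> bspec[OF xD] by (simp, blast)
  \<comment> \<open>The sphere of the span is symmetric, so the distance from \<open>- y\<close>
    bounds the sum; \<open>low\<close> puts \<open>- y\<close> into \<open>?K\<close>.\<close>
  have E1: "2 - \<eta> < N (x + y)" if "y \<in> ?E" "N y = 1" for y
  proof -
    from E_smul[OF that(1), of "-1"] obtain a where a: "- y = (\<Sum>k<n. smul (a k) (e k))"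
      by auto
    have "norm (a k) \<le> 1 / c" if "k < n" for k
    proof -
      have "norm (a k) \<le> (\<Sum>k<n. norm (a k))"
        using that by (intro member_le_sum) auto
      also have "\<dots> \<le> 1 / c"
        using low[of a] c \<open>N y = 1\<close> N_minus[of y] by (simp add: a[symmetric] field_simps)
      finally show ?thesis .
    qed
    then have "- y \<in> ?K" using a by blast
    then show ?thesis using x(2)[of "- y"] that(2) by simp
  qed
  have E2: "(1 - \<eta>) * (N y + 1) \<le> N (y + x)" if "y \<in> ?E" for y
  proof (cases "y = 0")
    case True
    then show ?thesis using x(1) \<eta> by simp
  next
    case False
    define r where "r = N y"
    have r: "r > 0" unfolding r_def using False N_nonneg[of y] N_eq_0[of y] by linarith
    define z where "z = (1 / r) *\<^sub>R y"
    have z: "z \<in> ?E" "N z = 1" "y = r *\<^sub>R z"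
      using E_smul[OF that, of "of_real (1 / r)", unfolded smul_of_real] r False
      by (simp_all add: z_def N_scaleR r_def)
    have xz: "2 - \<eta> < N (x + z)" by (rule E1[OF z(1,2)])
    \<comment> \<open>The shorter of \<open>x\<close> and \<open>y\<close> is stretched to the
      length of the longer. This produces a multiple of \<open>x + z\<close>, estimated by
      \<open>xz\<close>, and costs only the difference of the lengths.\<close>
    show ?thesis
    proof (cases "r \<ge> 1")
      case True
      have "r * (2 - \<eta>) \<le> N (r *\<^sub>R (x + z))"
        using xz r by (simp add: N_scaleR)
      also have "r *\<^sub>R (x + z) = (y + x) + (r - 1) *\<^sub>R x"
        by (simp add: z(3) algebra_simps)
      also have "N \<dots> \<le> N (y + x) + (r - 1)"
        using N_triangle[of "y + x" "(r - 1) *\<^sub>R x"] True x(1) by (simp add: N_scaleR)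
      finally show ?thesis using \<eta>(1) by (simp add: r_def[symmetric] algebra_simps)
    next
      case False
      have "2 - \<eta> \<le> N (x + z)" using xz by simp
      also have "x + z = (y + x) + (1 - r) *\<^sub>R z"
        by (simp add: z(3) algebra_simps)
      also have "N \<dots> \<le> N (y + x) + (1 - r)"
        using N_triangle[of "y + x" "(1 - r) *\<^sub>R z"] False z(2) by (simp add: N_scaleR)
      finally have "1 + r - \<eta> \<le> N (y + x)" by simp
      moreover have "0 \<le> \<eta> * r" using \<eta>(1) r by simp
      ultimately show ?thesis by (simp add: r_def[symmetric] algebra_simps)
    qed
  qed
  have "c' * ((\<Sum>k<n. norm (a k)) + norm t) \<le> N ((\<Sum>k<n. smul (a k) (e k)) + smul t x)" for a t
  proof (cases "t = 0")
    case True
    have "c' * (\<Sum>k<n. norm (a k)) \<le> c * (\<Sum>k<n. norm (a k))"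
      using c by (intro mult_right_mono sum_nonneg) auto
    then show ?thesis using True low[of a] by simp
  next
    case False
    define y where "y = (\<Sum>k<n. smul (a k) (e k))"
    \<comment> \<open>Dividing by \<open>t\<close> gives \<open>x\<close> the coefficient 1, so that
      \<open>E2\<close> applies.\<close>
    have y: "smul (1 / t) y \<in> ?E" by (rule E_smul) (auto simp: y_def)
    have "c' * ((\<Sum>k<n. norm (a k)) + norm t) \<le> (1 - \<eta>) * (c * (\<Sum>k<n. norm (a k)) + norm t)"
    proof -
      have "c * ((\<Sum>k<n. norm (a k)) + norm t) \<le> c * (\<Sum>k<n. norm (a k)) + norm t"
        using c mult_right_mono[of c 1 "norm t"] by (simp add: algebra_simps)
      then have "(1 - \<eta>) * (c * ((\<Sum>k<n. norm (a k)) + norm t))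
          \<le> (1 - \<eta>) * (c * (\<Sum>k<n. norm (a k)) + norm t)"
        using \<eta> by (intro mult_left_mono) auto
      then show ?thesis unfolding mult.assoc[symmetric] \<eta>(3) .
    qed
    also have "\<dots> \<le> (1 - \<eta>) * (N y + norm t)"
      using low[of a] \<eta> by (intro mult_left_mono) (auto simp: y_def)
    also have "\<dots> = norm t * ((1 - \<eta>) * (N (smul (1 / t) y) + 1))"
      using False by (simp add: N_smul norm_divide field_simps)
    also have "\<dots> \<le> norm t * N (smul (1 / t) y + x)"
      by (intro mult_left_mono E2 y) simp
    also have "\<dots> = N (y + smul t x)"
      unfolding N_smul[symmetric] using False by (simp add: scale_right_distrib)
    finally show ?thesis by (simp add: y_def)
  qed
  then show ?thesis using x(1) by blast
qed

lemma exists_l1_basis: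
  assumes "thickness N = 2"
  shows "\<exists>e :: nat \<Rightarrow> 'a. \<forall>n. N (e n) = 1 \<and>
    (\<forall>a. (\<Sum>k<n. norm (a k)) / 2 \<le> N (\<Sum>k<n. smul (a k) (e k)))"
proof -
  \<comment> \<open>The constants fall strictly from \<open>c 0 = 1\<close> but stay above 1/2:
    every extension has room for its loss and a uniform bound survives.\<close>
  define c :: "nat \<Rightarrow> real" where "c n = (1 + 1 / 2 ^ n) / 2" for n
  have c: "0 < c n" "c (Suc n) < c n" "c n \<le> 1" "1 / 2 \<le> c n" for n
    by (auto simp: c_def field_simps add_pos_pos)
  \<comment> \<open>\<open>P f n\<close> reads \<open>f\<close> only below \<open>n\<close>, as
    recursive choice requires. The constant is \<open>c (Suc n)\<close> because the estimate
    concerns \<open>n + 1\<close> vectors.\<close>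
  define P where "P f n x \<longleftrightarrow> N x = 1 \<and> (\<forall>a. c (Suc n) * ((\<Sum>k<n. norm (a k)) + norm (a n))
    \<le> N ((\<Sum>k<n. smul (a k) (f k)) + smul (a n) x))" for f n x
  have low: "c n * (\<Sum>k<n. norm (a k)) \<le> N (\<Sum>k<n. smul (a k) (f k))"
    if "\<And>k. k < n \<Longrightarrow> P f k (f k)" for f n a
  proof (cases n)
    case (Suc m)
    then show ?thesis using that[of m] by (simp add: P_def)
  qed simp
  have "\<exists>f. \<forall>n. P f n (f n)"
  proof (rule dependent_wellorder_choice)
    show "P f n x = P g n x" if "\<And>k. k < n \<Longrightarrow> f k = g k" for x f g n
      using that by (simp add: P_def)
    show "\<exists>x. P f n x" if "\<And>k. k < n \<Longrightarrow> P f k (f k)" for n f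
      using extend_l1_basis[OF assms c(1,2,3) low[OF that]] unfolding P_def by blast
  qed
  then obtain e where e: "\<And>n. P e n (e n)" by blast
  have "N (e n) = 1" for n
    using e[of n] by (simp add: P_def)
  moreover have "(\<Sum>k<n. norm (a k)) / 2 \<le> N (\<Sum>k<n. smul (a k) (e k))" for n a
  proof -
    have "(\<Sum>k<n. norm (a k)) / 2 \<le> c n * (\<Sum>k<n. norm (a k))"
      using mult_right_mono[OF c(4), of "\<Sum>k<n. norm (a k)" n] by (simp add: sum_nonneg)
    also have "\<dots> \<le> N (\<Sum>k<n. smul (a k) (e k))"
      by (rule low[OF e])
    finally show ?thesis .
  qed
  ultimately show ?thesis by blast
qed

text \<open>The embedding sums the series with terms \<open>smul (a k) (e k)\<close>, which
  converges absolutely because the \<open>e k\<close> are bounded.\<close>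

lemma contains_l1_if_thickness_2:
  assumes "thickness N = 2"
  shows "contains_l1 smul"
proof -
  obtain l u where l: "l > 0" and u: "u > 0"
    and "\<forall>x. l * norm x \<le> N x \<and> N x \<le> u * norm x"
    using N_bounds by blast
  then have lN: "l * norm x \<le> N x" and uN: "N x \<le> u * norm x" for x
    by blast+
  from exists_l1_basis[OF assms] obtain e :: "nat \<Rightarrow> 'a" where
    "\<forall>n. N (e n) = 1 \<and> (\<forall>a. (\<Sum>k<n. norm (a k)) / 2 \<le> N (\<Sum>k<n. smul (a k) (e k)))"
    by (rule exE)
  then have e: "N (e n) = 1"
    and low: "(\<Sum>k<n. norm (a k)) / 2 \<le> N (\<Sum>k<n. smul (a k) (e k))" for n a
    by simp_all
  define T where "T a = (\<Sum>k. smul (a k) (e k))" for a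
  have norm_e: "norm (smul b (e k)) \<le> 1 / l * norm b" for b k
    using mult_left_mono[OF lN[of "e k"], of "norm b"] l by (simp add: norm_smul e field_simps)
  have smry: "summable (\<lambda>k. 1 / l * norm (a k))" if "a \<in> l1" for a :: "nat \<Rightarrow> 'k"
    using l1_sums[OF that] by (intro summable_mult) (simp add: sums_iff)
  have nsmry: "summable (\<lambda>k. norm (smul (a k) (e k)))" if "a \<in> l1" for a
    by (rule summable_comparison_test'[OF smry[OF that], of 0]) (simp only: real_norm_def abs_norm_cancel norm_e)
  have smr: "summable (\<lambda>k. smul (a k) (e k))" if "a \<in> l1" for a
    by (rule summable_norm_cancel[OF nsmry[OF that]])
  have "l1_embedding smul T (2 * u) (1 / l)"
  proof
    fix a b :: "nat \<Rightarrow> 'k" and c assume a: "a \<in> l1"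
    show "T (\<lambda>n. a n + b n) = T a + T b" if "b \<in> l1"
      unfolding T_def scale_left_distrib by (rule suminf_add[symmetric]) (intro smr a that)+
    show "T (\<lambda>n. c * a n) = smul c (T a)"
      unfolding T_def scale_scale[symmetric]
      by (rule bounded_linear.suminf[OF bounded_linear_smul smr[OF a], symmetric])
    have "norm (T a) \<le> (\<Sum>k. norm (smul (a k) (e k)))"
      unfolding T_def by (rule summable_norm[OF nsmry[OF a]])
    also have "\<dots> \<le> (\<Sum>k. 1 / l * norm (a k))"
      by (rule suminf_le[OF norm_e nsmry[OF a] smry[OF a]])
    also have "\<dots> = 1 / l * l1_norm a"
      using sums_unique[OF sums_mult[OF l1_sums[OF a], of "1 / l"]] by simp
    finally show "norm (T a) \<le> 1 / l * l1_norm a" .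
    \<comment> \<open>The lower estimate for finite combinations passes to the limit, in the
      original norm.\<close>
    have "l1_norm a / 2 \<le> u * norm (T a)"
    proof (rule LIMSEQ_le)
      show "(\<lambda>n. (\<Sum>k<n. norm (a k)) / 2) \<longlonglongrightarrow> l1_norm a / 2"
        using l1_sums[OF a] by (intro tendsto_divide) (auto simp: sums_def)
      show "(\<lambda>n. u * norm (\<Sum>k<n. smul (a k) (e k))) \<longlonglongrightarrow> u * norm (T a)"
        unfolding T_def by (intro tendsto_intros summable_LIMSEQ smr a)
      show "\<exists>M. \<forall>n\<ge>M. (\<Sum>k<n. norm (a k)) / 2 \<le> u * norm (\<Sum>k<n. smul (a k) (e k))"
        using order_trans[OF low uN] by blast
    qed
    then show "l1_norm a \<le> 2 * u * norm (T a)" by simp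
  qed
  then show ?thesis by (rule l1_embedding.contains_l1)
qed

end

section \<open>Renorming a space that contains summable sequences\<close>

text \<open>Together with \<open>le_mult_cINF\<close>, this is how infima over \<open>l1\<close>,
  over chains and over cones inherit subadditivity and positive homogeneity.\<close>

lemma le_cINF_add:
  fixes f :: "'i \<Rightarrow> real" and g :: "'j \<Rightarrow> real"
  assumes "A \<noteq> {}" "B \<noteq> {}" "\<And>a b. a \<in> A \<Longrightarrow> b \<in> B \<Longrightarrow> z \<le> f a + g b"
  shows "z \<le> (INF a\<in>A. f a) + (INF b\<in>B. g b)"
proof -
  have "z - g b \<le> (INF a\<in>A. f a)" if "b \<in> B" for b
    using assms(3)[OF _ that] by (intro cINF_greatest assms(1)) (simp add: algebra_simps)
  then have "z - (INF a\<in>A. f a) \<le> (INF b\<in>B. g b)"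
    by (intro cINF_greatest assms(2)) (simp add: algebra_simps)
  then show ?thesis by simp
qed

lemma le_mult_cINF:
  fixes f :: "'i \<Rightarrow> real"
  assumes "A \<noteq> {}" "t > 0" "\<And>a. a \<in> A \<Longrightarrow> z \<le> t * f a"
  shows "z \<le> t * (INF a\<in>A. f a)"
proof -
  have "z / t \<le> (INF a\<in>A. f a)"
    using assms(2,3) by (intro cINF_greatest assms(1)) (simp add: field_simps)
  then show ?thesis using assms(2) by (simp add: field_simps)
qed

section \<open>Sublinear functionals and homogeneity\<close>

text \<open>Applying the second inequality with \<open>1 / t\<close> gives equality, so this is
  positive homogeneity; only real scalars enter.\<close>

definition sublinear :: "('a::real_vector \<Rightarrow> real) \<Rightarrow> bool"
  where "sublinear p \<longleftrightarrow>
    (\<forall>x y. p (x + y) \<le> p x + p y) \<and> (\<forall>t>0. \<forall>x. p (t *\<^sub>R x) \<le> t * p x)"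

text \<open>Members \<open>p\<close> and \<open>q\<close> that are nearly optimal at
  \<open>x\<close> and at \<open>y\<close> may differ, but the smaller of the two serves at both
  points.\<close>

lemma sublinear_chain_INF:
  assumes "C \<noteq> {}" and sub: "\<And>p. p \<in> C \<Longrightarrow> sublinear p"
    and chain: "\<And>p q. p \<in> C \<Longrightarrow> q \<in> C \<Longrightarrow> p \<le> q \<or> q \<le> p"
    and bdd: "\<And>x. bdd_below ((\<lambda>p. p x) ` C)"
  shows "sublinear (\<lambda>x. INF p\<in>C. p x)"
  unfolding sublinear_def
proof (intro conjI allI impI)
  fix x y
  show "(INF p\<in>C. p (x + y)) \<le> (INF p\<in>C. p x) + (INF p\<in>C. p y)"
  proof (rule le_cINF_add[OF assms(1,1)])
    fix p q assume pq: "p \<in> C" "q \<in> C"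
    have "(INF p\<in>C. p (x + y)) \<le> r x + r y" if "r \<in> C" for r
      using cINF_lower[OF bdd that, of "x + y"] sub[OF that] unfolding sublinear_def
      by (meson order_trans)
    from this[OF pq(1)] this[OF pq(2)]
    show "(INF p\<in>C. p (x + y)) \<le> p x + q y"
      using chain[OF pq] unfolding le_fun_def by (smt (verit))
  qed
next
  fix t :: real and x assume "t > 0"
  show "(INF p\<in>C. p (t *\<^sub>R x)) \<le> t * (INF p\<in>C. p x)"
  proof (rule le_mult_cINF[OF assms(1) \<open>t > 0\<close>])
    fix p assume p: "p \<in> C"
    have "p (t *\<^sub>R x) \<le> t * p x" using sub[OF p] \<open>t > 0\<close> unfolding sublinear_def by blast
    then show "(INF p\<in>C. p (t *\<^sub>R x)) \<le> t * p x"
      using cINF_lower[OF bdd p, of "t *\<^sub>R x"] by linarith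
  qed
qed

text \<open>The reverse inequality is the given one for \<open>inverse c\<close>; nonnegativity
  settles \<open>c = 0\<close>.\<close>

lemma norm_le_imp_homogeneous:
  fixes smul :: "'k::real_normed_field \<Rightarrow> 'a::ab_group_add \<Rightarrow> 'a" and f :: "'a \<Rightarrow> real"
  assumes "vector_space smul" and le: "\<And>c x. f (smul c x) \<le> norm c * f x" and nonneg: "\<And>x. 0 \<le> f x"
  shows "f (smul c x) = norm c * f x"
proof -
  interpret vector_space smul by fact
  show ?thesis
  proof (cases "c = 0")
    case True
    then show ?thesis using le[of 0 x] nonneg[of 0] by simp
  next
    case False
    have "f x \<le> norm (inverse c) * f (smul c x)"
      using le[of "inverse c" "smul c x"] False by simp
    then have "norm c * f x \<le> norm c * (norm (inverse c) * f (smul c x))"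
      by (rule mult_left_mono) simp
    also have "\<dots> = f (smul c x)"
      using False by (simp only: mult.assoc[symmetric] norm_mult[symmetric]) simp
    finally have "norm c * f x \<le> f (smul c x)" .
    then show ?thesis using le[of c x] by simp
  qed
qed

section \<open>Infimal convolutions along an embedding\<close>

context l1_embedding
begin

text \<open>The infimal convolution of the norm with \<open>\<mu>\<close> times the summable norm: for \<open>\<mu> = 0\<close> it is
  a multiple of the distance to the range of \<open>T\<close>, for \<open>\<mu> = 1\<close> it extends the summable norm.\<close>

definition infconv :: "real \<Rightarrow> 'a \<Rightarrow> real"
  where "infconv \<mu> x = (INF a\<in>l1. M * norm (x - T a) + \<mu> * l1_norm a)"

lemma l1_nonempty: "(l1 :: (nat \<Rightarrow> 'k) set) \<noteq> {}"
  using l1_zero(1) by blast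

context
  fixes \<mu> :: real
  assumes \<mu>: "0 \<le> \<mu>" "\<mu> \<le> 1"
begin

lemma infconv_lower: "a \<in> l1 \<Longrightarrow> infconv \<mu> x \<le> M * norm (x - T a) + \<mu> * l1_norm a"
  unfolding infconv_def using M_pos \<mu>
  by (intro cINF_lower bdd_belowI2[where m = 0]) auto

lemma infconv_greatest:
  "(\<And>a. a \<in> l1 \<Longrightarrow> z \<le> M * norm (x - T a) + \<mu> * l1_norm a) \<Longrightarrow> z \<le> infconv \<mu> x"
  unfolding infconv_def by (intro cINF_greatest l1_nonempty)

lemma infconv_nonneg: "0 \<le> infconv \<mu> x"
  using M_pos \<mu> by (intro infconv_greatest) auto

lemma infconv_le_norm: "infconv \<mu> x \<le> M * norm x"
  using infconv_lower[of "\<lambda>_. 0" x] by (simp add: T_zero)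

text \<open>Replacing \<open>a\<close> by \<open>b\<close> costs
  \<open>M * norm (T a - T b)\<close>. By \<open>T_lower\<close> and \<open>\<mu> \<le> 1\<close>
  this is at least what can be saved in the summable norm.\<close>

lemma infconv_T: "a \<in> l1 \<Longrightarrow> infconv \<mu> (T a) = \<mu> * l1_norm a"
proof (rule antisym)
  assume a: "a \<in> l1"
  show "infconv \<mu> (T a) \<le> \<mu> * l1_norm a"
    using infconv_lower[OF a, of "T a"] by simp
  show "\<mu> * l1_norm a \<le> infconv \<mu> (T a)"
  proof (rule infconv_greatest)
    fix b :: "nat \<Rightarrow> 'k" assume b: "b \<in> l1"
    have "l1_norm a \<le> l1_norm (\<lambda>n. a n - b n) + l1_norm b"
      using l1_add(2)[OF l1_diff[OF a b] b] by simp
    then have "\<mu> * l1_norm a \<le> \<mu> * l1_norm (\<lambda>n. a n - b n) + \<mu> * l1_norm b"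
      using \<mu> by (simp add: mult_left_mono distrib_left[symmetric])
    also have "\<mu> * l1_norm (\<lambda>n. a n - b n) \<le> M * norm (T a - T b)"
      using T_lower[OF l1_diff[OF a b]] mult_right_mono[OF \<mu>(2), of "l1_norm (\<lambda>n. a n - b n)"]
      by (simp add: T_diff a b)
    finally show "\<mu> * l1_norm a \<le> M * norm (T a - T b) + \<mu> * l1_norm b" by simp
  qed
qed

lemma infconv_triangle: "infconv \<mu> (x + y) \<le> infconv \<mu> x + infconv \<mu> y"
  unfolding infconv_def[of _ x] infconv_def[of _ y]
proof (rule le_cINF_add[OF l1_nonempty l1_nonempty])
  fix a b :: "nat \<Rightarrow> 'k" assume a: "a \<in> l1" and b: "b \<in> l1"
  have "infconv \<mu> (x + y) \<le> M * norm ((x - T a) + (y - T b)) + \<mu> * l1_norm (\<lambda>n. a n + b n)"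
    using infconv_lower[OF l1_add(1)[OF a b], of "x + y"] by (simp add: T_add a b algebra_simps)
  also have "\<dots> \<le> M * (norm (x - T a) + norm (y - T b)) + \<mu> * (l1_norm a + l1_norm b)"
    using M_pos \<mu> l1_add(2)[OF a b] by (intro add_mono mult_left_mono norm_triangle_ineq) auto
  finally show "infconv \<mu> (x + y)
      \<le> M * norm (x - T a) + \<mu> * l1_norm a + (M * norm (y - T b) + \<mu> * l1_norm b)"
    by (simp add: algebra_simps)
qed

lemma infconv_smul: "infconv \<mu> (smul c x) = norm c * infconv \<mu> x"
proof (rule norm_le_imp_homogeneous[OF vector_space_axioms _ infconv_nonneg])
  fix c x
  show "infconv \<mu> (smul c x) \<le> norm c * infconv \<mu> x"
  proof (cases "c = 0")
    case True
    then show ?thesis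
      using infconv_le_norm[of 0] by simp
  next
    case False
    show ?thesis
      unfolding infconv_def[of _ x]
    proof (rule le_mult_cINF[OF l1_nonempty])
      fix a :: "nat \<Rightarrow> 'k" assume a: "a \<in> l1"
      have "infconv \<mu> (smul c x) \<le> M * norm (smul c (x - T a)) + \<mu> * l1_norm (\<lambda>n. c * a n)"
        using infconv_lower[OF l1_scale(1)[OF a], of "smul c x" c]
        by (simp add: T_scale a scale_right_diff_distrib)
      also have "\<dots> = norm c * (M * norm (x - T a) + \<mu> * l1_norm a)"
        by (simp only: norm_smul l1_scale(2)[OF a]) (simp add: algebra_simps)
      finally show "infconv \<mu> (smul c x) \<le> norm c * (M * norm (x - T a) + \<mu> * l1_norm a)" .
    qed (use False in simp)
  qed
qed

end

section \<open>Admissible functionals and a minimal one\<close>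

text \<open>Symmetry is not imposed because \<open>minimal_admissible_cone\<close> modifies
  \<open>p\<close> in one direction only; it is restored in \<open>exists_renorming\<close>.\<close>

definition admissible :: "('a \<Rightarrow> real) set"
  where "admissible = {p. sublinear p \<and> p \<le> infconv 1 \<and> (\<forall>a\<in>l1. l1_norm a \<le> p (T a))}"

lemma admissibleD:
  assumes "p \<in> admissible"
  shows "p (x + y) \<le> p x + p y" "t > 0 \<Longrightarrow> p (t *\<^sub>R x) \<le> t * p x"
    "p x \<le> infconv 1 x" "a \<in> l1 \<Longrightarrow> l1_norm a \<le> p (T a)"
  using assms by (auto simp: admissible_def sublinear_def le_fun_def)

text \<open>A substitute for positivity: it bounds chains from below and makes the final seminorm
  nonnegative.\<close>

lemma admissible_nonneg_sum:
  assumes "p \<in> admissible"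
  shows "0 \<le> p x + p (- x)"
  using admissibleD(1)[OF assms, of x "- x"] admissibleD(4)[OF assms, of "\<lambda>_. 0"]
  by (simp add: T_zero)

lemma infconv_admissible: "infconv 1 \<in> admissible"
  unfolding admissible_def sublinear_def
proof (intro CollectI conjI allI impI ballI)
  show "infconv 1 (t *\<^sub>R x) \<le> t * infconv 1 x" if "t > 0" for t x
    using that infconv_smul[of 1 "of_real t" x] by (simp add: smul_of_real)
qed (simp_all add: infconv_triangle infconv_T)

text \<open>Zorn's lemma for the reversed pointwise order; a chain is bounded by its pointwise
  infimum.\<close>

lemma exists_minimal_admissible:
  "\<exists>p\<in>admissible. \<forall>q\<in>admissible. q \<le> p \<longrightarrow> q = p"
proof -
  let ?R = "relation_of (\<lambda>p q. q \<le> p) admissible"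
  have "\<exists>u\<in>admissible. \<forall>p\<in>C. u \<le> p" if "C \<in> Chains ?R" for C
  proof (cases "C = {}")
    case True
    then show ?thesis using infconv_admissible by blast
  next
    case False
    have C: "C \<subseteq> admissible" by (rule Chains_relation_of[OF that])
    have chain: "p \<le> q \<or> q \<le> p" if "p \<in> C" "q \<in> C" for p q
      using \<open>C \<in> Chains ?R\<close> that unfolding Chains_def relation_of_def by auto
    have bdd: "bdd_below ((\<lambda>p. p x) ` C)" for x
    \<comment> \<open>The bound does not depend on \<open>p\<close>: it comes from
      \<open>p x \<ge> - p (- x)\<close> and the common upper bound at \<open>- x\<close>.\<close>
    proof (rule bdd_belowI2[where m = "- infconv 1 (- x)"])
      show "- infconv 1 (- x) \<le> p x" if "p \<in> C" for p
        using that C admissible_nonneg_sum[of p x] admissibleD(3)[of p "- x"] by fastforce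
    qed
    obtain p0 where p0: "p0 \<in> C" using False by blast
    let ?u = "\<lambda>x. INF p\<in>C. p x"
    have lower: "?u x \<le> p x" if "p \<in> C" for p x
      by (rule cINF_lower[OF bdd that])
    have "?u \<in> admissible"
      unfolding admissible_def
    proof (intro CollectI conjI ballI)
      show "sublinear ?u"
        using C by (intro sublinear_chain_INF False chain bdd) (auto simp: admissible_def)
      show "?u \<le> infconv 1"
        using lower[OF p0] admissibleD(3)[of p0] p0 C by (auto simp: le_fun_def intro: order_trans)
      show "l1_norm a \<le> ?u (T a)" if "a \<in> l1" for a
        using that C admissibleD(4) by (intro cINF_greatest False) auto
    qed
    moreover have "?u \<le> p" if "p \<in> C" for p
      using lower[OF that] by (simp add: le_fun_def)
    ultimately show ?thesis by (intro bexI[of _ ?u]) auto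
  qed
  then show ?thesis
    by (intro predicate_Zorn partial_order_on_relation_ofI) auto
qed

text \<open>The summable norm is additive on these cones, so that the infimal convolutions along them
  in \<open>minimal_admissible_cone\<close> stay sublinear.\<close>

definition cone :: "'k \<Rightarrow> nat \<Rightarrow> (nat \<Rightarrow> 'k) set"
  where "cone \<sigma> n = {w \<in> l1. \<forall>k. \<exists>t\<ge>0. w k = of_real t * \<sigma> \<and> (k < n \<longrightarrow> t = 0)}"

lemma cone_zero: "(\<lambda>_. 0) \<in> cone \<sigma> n"
  by (auto simp: cone_def intro: exI[of _ 0])

text \<open>No cancellation occurs, since the coordinates are nonnegative multiples of one scalar
  \<open>\<sigma>\<close>.\<close>

lemma cone_add:
  assumes "v \<in> cone \<sigma> n" "w \<in> cone \<sigma> n"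
  shows "(\<lambda>k. v k + w k) \<in> cone \<sigma> n" "l1_norm (\<lambda>k. v k + w k) = l1_norm v + l1_norm w"
proof -
  from assms have l1: "v \<in> l1" "w \<in> l1"
    and "\<forall>k. \<exists>t\<ge>0. v k = of_real t * \<sigma> \<and> (k < n \<longrightarrow> t = 0)"
    and "\<forall>k. \<exists>t\<ge>0. w k = of_real t * \<sigma> \<and> (k < n \<longrightarrow> t = 0)"
    by (simp_all add: cone_def)
  then obtain s t where st: "\<And>k. s k \<ge> 0 \<and> v k = of_real (s k) * \<sigma> \<and> (k < n \<longrightarrow> s k = 0)"
    "\<And>k. t k \<ge> 0 \<and> w k = of_real (t k) * \<sigma> \<and> (k < n \<longrightarrow> t k = 0)"
    by metis
  have "\<exists>r\<ge>0. v k + w k = of_real r * \<sigma> \<and> (k < n \<longrightarrow> r = 0)" for k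
    using st(1)[of k] st(2)[of k] by (intro exI[of _ "s k + t k"]) (auto simp: distrib_right)
  then show "(\<lambda>k. v k + w k) \<in> cone \<sigma> n"
    using l1_add(1)[OF l1] by (simp add: cone_def)
  have "norm (v k + w k) = norm (v k) + norm (w k)" for k
  proof -
    have "v k + w k = of_real (s k + t k) * \<sigma>"
      using st(1)[of k] st(2)[of k] by (simp add: distrib_right)
    then have "norm (v k + w k) = (s k + t k) * norm \<sigma>"
      using st(1)[of k] st(2)[of k] by (simp only: norm_mult norm_of_real) simp
    then show ?thesis
      using st(1)[of k] st(2)[of k] by (simp add: norm_mult distrib_right)
  qed
  then have "(\<lambda>k. norm (v k + w k)) sums (l1_norm v + l1_norm w)"
    using sums_add[OF l1_sums[OF l1(1)] l1_sums[OF l1(2)]] by simp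
  then show "l1_norm (\<lambda>k. v k + w k) = l1_norm v + l1_norm w"
    by (rule l1I_sums)
qed

lemma cone_scale:
  assumes "w \<in> cone \<sigma> n" "s > 0"
  shows "(\<lambda>k. of_real s * w k) \<in> cone \<sigma> n"
  unfolding cone_def
proof (intro CollectI conjI allI)
  show "(\<lambda>k. of_real s * w k) \<in> l1"
    using assms by (intro l1_scale) (simp add: cone_def)
  fix k
  obtain t where "t \<ge> 0" "w k = of_real t * \<sigma>" "k < n \<longrightarrow> t = 0"
    using assms(1) by (auto simp: cone_def)
  then show "\<exists>t\<ge>0. of_real s * w k = of_real t * \<sigma> \<and> (k < n \<longrightarrow> t = 0)"
    using assms(2) by (intro exI[of _ "s * t"]) auto
qed

lemma cone_antimono: "m \<le> n \<Longrightarrow> cone \<sigma> n \<subseteq> cone \<sigma> m"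
  unfolding cone_def by (intro Collect_mono conj_mono all_mono ex_mono) (auto dest: less_le_trans)

lemma cone_unit_seq: "k \<ge> n \<Longrightarrow> (\<lambda>j. \<sigma> * unit_seq k j) \<in> cone \<sigma> n"
  unfolding cone_def
proof (intro CollectI conjI allI)
  assume "k \<ge> n"
  show "(\<lambda>j. \<sigma> * unit_seq k j) \<in> l1"
    by (rule l1_scale) simp
  show "\<exists>t\<ge>0. \<sigma> * unit_seq k j = of_real t * \<sigma> \<and> (j < n \<longrightarrow> t = 0)" for j
    using \<open>k \<ge> n\<close> by (intro exI[of _ "if j = k then 1 else 0"]) (auto simp: unit_seq_def)
qed

text \<open>Far along the cone, a minimal \<open>p\<close> behaves like a direct sum with a summable norm: otherwise
  the functional \<open>p'\<close> below would be admissible and smaller.\<close>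

lemma minimal_admissible_cone:
  assumes p: "p \<in> admissible" and min: "\<And>q. q \<in> admissible \<Longrightarrow> q \<le> p \<Longrightarrow> q = p"
    and "\<epsilon> > 0"
  shows "\<exists>n. \<forall>w\<in>cone \<sigma> n. p x + l1_norm w - \<epsilon> \<le> p (x + T w)"
proof -
  note p_add = admissibleD(1)[OF p]
  have cl1: "w \<in> l1" if "w \<in> cone \<sigma> n" for w n
    using that by (simp add: cone_def)
  have cne: "cone \<sigma> n \<noteq> {}" for n
    using cone_zero by blast
  have low: "- p (- x) \<le> p (x + T w) - l1_norm w" if "w \<in> l1" for w x
    using p_add[of "x + T w" "- x"] admissibleD(4)[OF p that] by simp
  \<comment> \<open>The least excess of \<open>p\<close> over the summable norm when moving from
    \<open>x\<close> along the cone; \<open>low\<close> keeps it finite.\<close>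
  define g where "g n x = (INF w\<in>cone \<sigma> n. p (x + T w) - l1_norm w)" for n x
  have g_lower: "g n x \<le> p (x + T w) - l1_norm w" if "w \<in> cone \<sigma> n" for n x w
    unfolding g_def by (intro cINF_lower that bdd_belowI2[OF low[OF cl1]])
  have g_le: "g n x \<le> p x" for n x
    using g_lower[OF cone_zero, of n x] by (simp add: T_zero)
  have g_mono: "g m x \<le> g n x" if "m \<le> n" for m n x
    unfolding g_def[of n] using cone_antimono[OF that] by (intro cINF_greatest cne g_lower) auto
  \<comment> \<open>The supremum pushes the cones to infinity; there they hardly interact with a
    fixed \<open>a\<close>, which keeps \<open>p'\<close> above the summable norm on the
    range.\<close>
  define p' where "p' x = (SUP n. g n x)" for x
  have g_le_p': "g n x \<le> p' x" for n x
    unfolding p'_def by (intro cSUP_upper UNIV_I bdd_aboveI2[OF g_le])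
  have p'_le: "p' x \<le> z" if "\<And>n. g n x \<le> z" for x z
    unfolding p'_def using that by (intro cSUP_least) auto
  have "p' \<in> admissible"
    unfolding admissible_def sublinear_def
  proof (intro CollectI conjI allI impI ballI)
    show "p' (x + y) \<le> p' x + p' y" for x y
    proof (rule p'_le)
      fix n
      have "g n (x + y) \<le> g n x + g n y"
        unfolding g_def[of n x] g_def[of n y]
      proof (rule le_cINF_add[OF cne cne])
        fix v w assume vw: "v \<in> cone \<sigma> n" "w \<in> cone \<sigma> n"
        have "g n (x + y) \<le> p ((x + T v) + (y + T w)) - (l1_norm v + l1_norm w)"
          using g_lower[OF cone_add(1)[OF vw], of "x + y"] vw
          by (simp add: cone_add(2)[OF vw] T_add[OF cl1 cl1] algebra_simps)
        then show "g n (x + y) \<le> p (x + T v) - l1_norm v + (p (y + T w) - l1_norm w)"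
          using p_add[of "x + T v" "y + T w"] by simp
      qed
      then show "g n (x + y) \<le> p' x + p' y"
        using g_le_p'[of n x] g_le_p'[of n y] by simp
    qed
    show "p' (t *\<^sub>R x) \<le> t * p' x" if t: "t > 0" for t x
    proof (rule p'_le)
      fix n
      have "g n (t *\<^sub>R x) \<le> t * g n x"
        unfolding g_def[of n x]
      proof (rule le_mult_cINF[OF cne t])
        fix w assume w: "w \<in> cone \<sigma> n"
        have "g n (t *\<^sub>R x) \<le> p (t *\<^sub>R (x + T w)) - t * l1_norm w"
          using g_lower[OF cone_scale[OF w t], of "t *\<^sub>R x"] t
          by (simp add: T_scale[OF cl1[OF w]] l1_scale(2)[OF cl1[OF w]] smul_of_real
              scaleR_right_distrib)
        also have "\<dots> \<le> t * p (x + T w) - t * l1_norm w"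
          using admissibleD(2)[OF p t, of "x + T w"] by simp
        finally show "g n (t *\<^sub>R x) \<le> t * (p (x + T w) - l1_norm w)"
          by (simp add: right_diff_distrib)
      qed
      also have "\<dots> \<le> t * p' x"
        using g_le_p' t by (intro mult_left_mono) auto
      finally show "g n (t *\<^sub>R x) \<le> t * p' x" .
    qed
    show "p' \<le> infconv 1"
      using p'_le[OF g_le] admissibleD(3)[OF p] by (auto simp: le_fun_def intro: order_trans)
    fix a :: "nat \<Rightarrow> 'k" assume a: "a \<in> l1"
    show "l1_norm a \<le> p' (T a)"
    proof (rule field_le_epsilon)
      fix \<delta> :: real assume "\<delta> > 0"
      \<comment> \<open>From this \<open>n\<close> on, adding a cone element to \<open>a\<close>
        raises the norm by almost its full norm, so the subtraction in \<open>g\<close> loses at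
        most \<open>\<delta>\<close>.\<close>
      from l1_norm_add_tail[OF a this] obtain n where
        n: "\<forall>w\<in>l1. (\<forall>k<n. w k = 0) \<longrightarrow> l1_norm a + l1_norm w - \<delta> \<le> l1_norm (\<lambda>k. a k + w k)"
        by (rule exE)
      have "l1_norm a - \<delta> \<le> g n (T a)"
        unfolding g_def
      proof (rule cINF_greatest[OF cne])
        fix w assume w: "w \<in> cone \<sigma> n"
        have "\<forall>k<n. w k = 0" using w by (fastforce simp: cone_def)
        then have "l1_norm a + l1_norm w - \<delta> \<le> l1_norm (\<lambda>k. a k + w k)"
          using bspec[OF n cl1[OF w]] by (rule mp[rotated])
        also have "\<dots> \<le> p (T a + T w)"
          using admissibleD(4)[OF p l1_add(1)[OF a cl1[OF w]]] by (simp add: T_add a cl1[OF w])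
        finally show "l1_norm a - \<delta> \<le> p (T a + T w) - l1_norm w" by simp
      qed
      then show "l1_norm a \<le> p' (T a) + \<delta>"
        using g_le_p'[of n "T a"] by simp
    qed
  qed
  moreover have "p' \<le> p"
    using p'_le[OF g_le] by (simp add: le_fun_def)
  ultimately have "p' = p"
    by (rule min)
  then have "p' x = p x" by simp
  \<comment> \<open>Minimality has made the supremum equal to \<open>p x\<close>, so a single
    \<open>n\<close> comes within \<open>\<epsilon>\<close> of it.\<close>
  then have "p x - \<epsilon> < (SUP n. g n x)"
    using \<open>\<epsilon> > 0\<close> by (simp add: p'_def)
  then have "\<exists>n\<in>UNIV. p x - \<epsilon> < g n x"
    by (subst (asm) less_cSUP_iff[OF UNIV_not_empty bdd_aboveI2[OF g_le]])
  then obtain n where "p x - \<epsilon> < g n x"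
    by blast
  then have "p x + l1_norm w - \<epsilon> \<le> p (x + T w)" if "w \<in> cone \<sigma> n" for w
    using g_lower[OF that, of x] by simp
  then show ?thesis by blast
qed

section \<open>The norm of thickness two\<close>

lemma exists_renorming:
  "\<exists>N. equivalent_norm smul N \<and> thickness N = 2"
proof -
  obtain p where p: "p \<in> admissible" and min: "\<And>q. q \<in> admissible \<Longrightarrow> q \<le> p \<Longrightarrow> q = p"
    using exists_minimal_admissible by blast
  note p_add = admissibleD(1)[OF p]
  \<comment> \<open>The supremum over unimodular scalars recovers the homogeneity that
    \<open>p\<close> may lack.\<close>
  define s where "s x = (SUP \<theta>\<in>sphere 0 1. p (smul \<theta> x))" for x
  have sph: "1 \<in> (sphere 0 1 :: 'k set)" "-1 \<in> (sphere 0 1 :: 'k set)" by simp_all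
  then have sne: "(sphere 0 1 :: 'k set) \<noteq> {}" by blast
  have p_le: "p (smul \<theta> x) \<le> infconv 1 x" if "\<theta> \<in> sphere 0 1" for \<theta> x
    using admissibleD(3)[OF p, of "smul \<theta> x"] that by (simp add: infconv_smul)
  have s_bdd: "bdd_above ((\<lambda>\<theta>. p (smul \<theta> x)) ` sphere 0 1)" for x
    by (rule bdd_aboveI2[OF p_le])
  have s_upper: "p (smul \<theta> x) \<le> s x" if "\<theta> \<in> sphere 0 1" for \<theta> x
    unfolding s_def by (rule cSUP_upper[OF that s_bdd])
  have s_least: "s x \<le> z" if "\<And>\<theta>. \<theta> \<in> sphere 0 1 \<Longrightarrow> p (smul \<theta> x) \<le> z" for x z
    unfolding s_def using that by (intro cSUP_least sne)
  have s_le: "s x \<le> infconv 1 x" for x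
    by (rule s_least[OF p_le])
  have s_nonneg: "0 \<le> s x" for x
    using admissible_nonneg_sum[OF p, of x] s_upper[OF sph(1), of x] s_upper[OF sph(2), of x]
    by simp
  have s_triangle: "s (x + y) \<le> s x + s y" for x y
  proof (rule s_least)
    fix \<theta> :: 'k assume t: "\<theta> \<in> sphere 0 1"
    show "p (smul \<theta> (x + y)) \<le> s x + s y"
      using p_add[of "smul \<theta> x" "smul \<theta> y"] s_upper[OF t, of x] s_upper[OF t, of y]
      by (simp add: scale_right_distrib)
  qed
  have s_smul: "s (smul c x) = norm c * s x" for c x
  proof (rule norm_le_imp_homogeneous[OF vector_space_axioms _ s_nonneg])
    fix c x
    show "s (smul c x) \<le> norm c * s x"
    proof (cases "c = 0")
      case True
      then show ?thesis using s_le[of 0] infconv_le_norm[of 1 0] by simp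
    next
      case False
      show ?thesis
      proof (rule s_least)
        fix \<theta> :: 'k assume t: "\<theta> \<in> sphere 0 1"
        \<comment> \<open>The unimodular part of \<open>\<theta> * c\<close>; the modulus is then a
          positive real factor, which sublinearity handles.\<close>
        define \<phi> where "\<phi> = \<theta> * c / of_real (norm c)"
        have "\<theta> * c = of_real (norm c) * \<phi>"
          using False by (simp add: \<phi>_def)
        then have "p (smul \<theta> (smul c x)) = p (norm c *\<^sub>R smul \<phi> x)"
          by (simp add: smul_of_real[symmetric])
        also have "\<dots> \<le> norm c * p (smul \<phi> x)"
          using False by (intro admissibleD(2)[OF p]) simp
        also have "\<dots> \<le> norm c * s x"
          using t False by (intro mult_left_mono s_upper) (auto simp: \<phi>_def norm_mult norm_divide)
        finally show "p (smul \<theta> (smul c x)) \<le> norm c * s x" .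
      qed
    qed
  qed
  \<comment> \<open>The lower bound on \<open>p\<close> concerns only the range of \<open>T\<close>.
    The distance term makes the sum definite elsewhere and vanishes on the
    \<open>e k\<close>.\<close>
  define N where "N x = s x + infconv 0 x" for x
  have N_upper: "N x \<le> 2 * M * norm x" for x
    using s_le[of x] infconv_le_norm[of 1 x] infconv_le_norm[of 0 x] by (simp add: N_def)
  \<comment> \<open>In \<open>norm x \<le> norm (x - T a) + norm (T a)\<close>, the part
    \<open>1 / M\<close> pays for the first term and \<open>C\<close> for the second.\<close>
  define K where "K = 1 / M + C"
  have "K > 0" using M_pos C_pos by (simp add: K_def add_pos_pos)
  have N_lower: "norm x \<le> K * N x" for x
  proof -
    have "norm x - C * s x \<le> K * infconv 0 x"
      unfolding infconv_def
    proof (rule le_mult_cINF[OF l1_nonempty \<open>K > 0\<close>])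
      fix a :: "nat \<Rightarrow> 'k" assume a: "a \<in> l1"
      have "l1_norm a \<le> p (T a)" by (rule admissibleD(4)[OF p a])
      also have "\<dots> \<le> p x + p (T a - x)"
        using p_add[of x "T a - x"] by simp
      also have "\<dots> \<le> s x + M * norm (x - T a)"
        using s_upper[OF sph(1), of x] admissibleD(3)[OF p, of "T a - x"]
          infconv_le_norm[of 1 "T a - x"] by (simp add: norm_minus_commute)
      finally have "C * l1_norm a \<le> C * (s x + M * norm (x - T a))"
        using C_pos by (intro mult_left_mono) auto
      moreover have "norm x \<le> norm (x - T a) + norm (T a)"
        using norm_triangle_ineq[of "x - T a" "T a"] by simp
      ultimately have "norm x \<le> norm (x - T a) + C * (s x + M * norm (x - T a))"
        using T_upper[OF a] by linarith
      then show "norm x - C * s x \<le> K * (M * norm (x - T a) + 0 * l1_norm a)"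
        using M_pos by (simp add: K_def algebra_simps)
    qed
    moreover have "C * s x \<le> K * s x"
      using M_pos s_nonneg by (intro mult_right_mono) (auto simp: K_def)
    ultimately show ?thesis by (simp add: N_def algebra_simps)
  qed
  have equiv: "equivalent_norm smul N"
    unfolding equivalent_norm_def is_norm_def
  proof (intro conjI allI)
    show nonneg: "0 \<le> N x" for x
      using s_nonneg infconv_nonneg[of 0] by (simp add: N_def)
    show "N x = 0 \<longleftrightarrow> x = 0" for x
      using N_lower[of x] N_upper[of 0] nonneg[of 0] by auto
    show "N (x + y) \<le> N x + N y" for x y
      using s_triangle[of x y] infconv_triangle[of 0 x y] by (simp add: N_def)
    show "N (smul c x) = norm c * N x" for c x
      by (simp add: N_def s_smul infconv_smul distrib_left)
    have "1 / K * norm x \<le> N x" for x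
      using N_lower[of x] \<open>K > 0\<close> by (simp add: field_simps)
    then show "\<exists>c>0. \<exists>C>0. \<forall>x. c * norm x \<le> N x \<and> N x \<le> C * norm x"
      using N_upper \<open>K > 0\<close> M_pos
      by (intro exI[of _ "1 / K"] conjI exI[of _ "2 * M"]) auto
  qed
  interpret N: equivalent_renorming smul N
    by unfold_locales (rule equiv)
  define e where "e k = T (unit_seq k)" for k
  have e0: "infconv 0 (e k) = 0" for k
    by (simp add: e_def infconv_T)
  have N_e: "N (e k) = 1" for k
  proof -
    have "s (e k) \<le> 1"
      using s_le[of "e k"] by (simp add: e_def infconv_T)
    moreover have "1 \<le> s (e k)"
      using s_upper[OF sph(1), of "e k"] admissibleD(4)[OF p l1_unit_seq(1), of k]
      by (simp add: e_def)
    ultimately show ?thesis by (simp add: N_def e0)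
  qed
  have far: "\<exists>n. \<forall>k\<ge>n. \<epsilon> < N (e k - y)" if y: "N y = 1" and "\<epsilon> < 2" for y \<epsilon>
  proof -
    \<comment> \<open>Two losses of \<open>\<delta>\<close> follow, from the choice of
      \<open>\<theta>\<close> and from the cone estimate; a third of the gap leaves the result
      strict.\<close>
    define \<delta> where "\<delta> = (2 - \<epsilon>) / 3"
    have \<delta>: "\<delta> > 0" using that(2) by (simp add: \<delta>_def)
    have "s y - \<delta> < (SUP \<theta>\<in>sphere 0 1. p (smul \<theta> y))"
      using \<delta> by (simp add: s_def)
    then have "\<exists>\<theta>\<in>sphere 0 1. s y - \<delta> < p (smul \<theta> y)"
      by (subst (asm) less_cSUP_iff[OF sne s_bdd])
    then obtain \<theta> where th: "\<theta> \<in> sphere 0 1" "s y - \<delta> < p (smul \<theta> y)"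
      by blast
    \<comment> \<open>The direction is \<open>- \<theta>\<close> because subtracting
      \<open>e k\<close> from \<open>y\<close> adds \<open>- \<theta>\<close> times a unit vector
      once \<open>\<theta>\<close> is applied.\<close>
    obtain n where n: "\<And>w. w \<in> cone (- \<theta>) n \<Longrightarrow> p (smul \<theta> y) + l1_norm w - \<delta> \<le> p (smul \<theta> y + T w)"
      using minimal_admissible_cone[OF p min \<delta>, of "- \<theta>" "smul \<theta> y"] by blast
    have "\<epsilon> < N (e k - y)" if "k \<ge> n" for k
    proof -
      have "smul \<theta> y + T (\<lambda>j. (- \<theta>) * unit_seq k j) = smul \<theta> (y - e k)"
        by (simp only: T_scale[OF l1_unit_seq(1)]) (simp add: e_def scale_right_diff_distrib)
      moreover have "l1_norm (\<lambda>j. (- \<theta>) * unit_seq k j) = 1"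
        using th(1) by (simp only: l1_scale(2)[OF l1_unit_seq(1)]) simp
      ultimately have "p (smul \<theta> y) + 1 - \<delta> \<le> p (smul \<theta> (y - e k))"
        using n[OF cone_unit_seq[OF that]] by simp
      then have "s y + 1 - 2 * \<delta> < s (y - e k)"
        using th(2) s_upper[OF th(1), of "y - e k"] by simp
      moreover have "infconv 0 y \<le> infconv 0 (y - e k)"
        using infconv_triangle[of 0 "y - e k" "e k"] by (simp add: e0)
      ultimately have "\<epsilon> < N (y - e k)"
        using y \<delta> by (simp add: N_def \<delta>_def field_simps)
      then show ?thesis by (simp add: N.N_minus_commute)
    qed
    then show ?thesis by blast
  qed
  have "thickness N = 2"
  proof (rule N.thickness_2I[OF N_e])
    fix F \<epsilon> assume F: "finite F" "F \<subseteq> unit_sphere N" and "\<epsilon> < (2 :: real)"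
    \<comment> \<open>Each \<open>y\<close> allows all large \<open>k\<close>, so finitely many of
      them share one \<open>e k\<close>.\<close>
    have "\<forall>\<^sub>F k in sequentially. \<forall>y\<in>F. \<epsilon> < N (e k - y)"
    proof (rule eventually_ball_finite[OF F(1)], rule ballI)
      fix y assume "y \<in> F"
      then have "N y = 1" using F(2) by (auto simp: unit_sphere_def)
      then show "\<forall>\<^sub>F k in sequentially. \<epsilon> < N (e k - y)"
        unfolding eventually_sequentially using \<open>\<epsilon> < 2\<close> by (rule far)
    qed
    then obtain k where "\<forall>y\<in>F. \<epsilon> < N (e k - y)"
      by (auto simp: eventually_sequentially)
    then show "\<exists>x. N x = 1 \<and> (\<forall>y\<in>F. \<epsilon> < N (x - y))"
      using N_e by blast
  qed
  then show ?thesis using equiv by blast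
qed

end

section \<open>The equivalence, for real and complex scalars\<close>

lemma (in normed_scalars) thickness_2_iff_contains_l1:
  "(\<exists>N. equivalent_norm smul N \<and> thickness N = 2) \<longleftrightarrow> contains_l1 smul"
proof
  assume "\<exists>N. equivalent_norm smul N \<and> thickness N = 2"
  then obtain N where N: "equivalent_norm smul N" "thickness N = 2" by blast
  then interpret equivalent_renorming smul N
    by unfold_locales
  show "contains_l1 smul"
    by (rule contains_l1_if_thickness_2[OF N(2)])
next
  assume "contains_l1 smul"
  then show "\<exists>N. equivalent_norm smul N \<and> thickness N = 2"
    unfolding contains_l1_iff by (auto intro: l1_embedding.exists_renorming)
qed

theorem theorem1p2:
  fixes smulC :: "complex \<Rightarrow> 'b::banach \<Rightarrow> 'b"
  shows "(separable_space (euclidean :: 'a::banach topology) \<longrightarrow>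
      ((\<exists>N :: 'a \<Rightarrow> real. equivalent_norm scaleR N \<and> thickness N = 2) \<longleftrightarrow>
        contains_l1 (scaleR :: real \<Rightarrow> 'a \<Rightarrow> 'a))) \<and>
    (complex_banach smulC \<and> separable_space (euclidean :: 'b topology) \<longrightarrow>
      ((\<exists>N :: 'b \<Rightarrow> real. equivalent_norm smulC N \<and> thickness N = 2) \<longleftrightarrow>
        contains_l1 smulC))"
proof (intro conjI impI)
  have "vector_space (scaleR :: real \<Rightarrow> 'a \<Rightarrow> 'a)"
    by unfold_locales (simp_all add: scaleR_right_distrib scaleR_left_distrib)
  then interpret R: normed_scalars "scaleR :: real \<Rightarrow> 'a \<Rightarrow> 'a"
    by (auto simp: normed_scalars_def normed_scalars_axioms_def)
  show "(\<exists>N :: 'a \<Rightarrow> real. equivalent_norm scaleR N \<and> thickness N = 2) \<longleftrightarrow>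
      contains_l1 (scaleR :: real \<Rightarrow> 'a \<Rightarrow> 'a)"
    by (rule R.thickness_2_iff_contains_l1)
next
  assume "complex_banach smulC \<and> separable_space (euclidean :: 'b topology)"
  then interpret C: normed_scalars smulC
    by (auto simp: normed_scalars_def normed_scalars_axioms_def complex_banach_def
        complex_banach_axioms_def)
  show "(\<exists>N :: 'b \<Rightarrow> real. equivalent_norm smulC N \<and> thickness N = 2) \<longleftrightarrow> contains_l1 smulC"
    by (rule C.thickness_2_iff_contains_l1)
qed

end
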